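(* Let $n\ge2$ be an integer, $N=2n+1$, $m_0=+1$ or $-1$, $m_N=-m_0$ and $m_j=m_0$ for $1\le j\le 2n=N-1$. Let $0\le\theta_0<2\pi$ and $0<a_1<a_2$ be constants, and $\theta_n^j=\frac{2(j-1)\pi}{n}+\theta_0$, $\alpha_n^j=\frac{2(j-1)\pi}{n}+\frac{\pi}{n}+\theta_0$ for $1\le j\le n$. Consider the system $$\dot{\mathbf x}_j(t)=2m_j\sum_{k=1,k\ne j}^N m_k\frac{\mathbf x_j(t)-\mathbf x_k(t)}{|\mathbf x_j(t)-\mathbf x_k(t)|^2},\qquad 1\le j\le N,\quad t>0,$$ with initial data $$\mathbf x_N(0)=\mathbf 0,\qquad \mathbf x_j(0)=a_1(\cos\theta_n^j,\sin\theta_n^j)^T,\qquad \mathbf x_{n+j}(0)=a_2(\cos\alpha_n^j,\sin\alpha_n^j)^T,\qquad 1\le j\le n.$$ Then the solution can be given as $$\mathbf x_N(t)\equiv\mathbf 0,\qquad \mathbf x_j(t)=\sqrt{\rho_1(t)}\,(\cos\theta_n^j,\sin\theta_n^j)^T,\qquad \mathbf x_{n+j}(t)=\sqrt{\rho_2(t)}\,(\cos\alpha_n^j,\sin\alpha_n^j)^T,\qquad 1\le j\le n,$$ where: (i) when $n=2$, only the three vortices $\mathbf x_1(t)$, $\mathbf x_2(t)$ and $\mathbf x_5(t)$ form a collision cluster among the $5$ vortices and they will collide at the origin $(0,0)^T$ in finite time; (ii) when $n=3$, $$\rho_1(t)\sim\left(\frac{a_1a_2}{a_2-a_1}\right)^2,\qquad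 \rho_2(t)\sim12t,\qquad t\gg1;$$ (iii) when $n\ge4$, $$\rho_1(t)\sim\alpha_6t,\qquad \rho_2(t)\sim\beta_6t,\qquad t\gg1,$$ with $\alpha_6$ and $\beta_6$ being two positive constants satisfying $$0<\alpha_6<\beta_6,\qquad \alpha_6+\beta_6=8n-12,\qquad \beta_6-\alpha_6=4n\,\frac{\beta_6^{n/2}-\alpha_6^{n/2}}{\beta_6^{n/2}+\alpha_6^{n/2}} .$$ Specifically, when $n\gg1$, $\alpha_6\approx2n-6$ and $\beta_6\approx6n-6$.
   Context: Here $\mathbf x_j(t)\in\mathbb R^2$ is the center of the $j$-th of $N$ quantized vortices and $m_j\in\{+1,-1\}$ is its winding number. The notation $f(t)\sim g(t)$, $t\gg1$, is the usual notation for asymptotic behaviour at large time. The symbol $\approx$ for $n\gg1$ denotes approximate equality for large $n$, with no quantitative error specified. For a set $I\subseteq\{1,\dots,N\}$ with at least two elements, the vortices in $I$ form a (finite time) collision cluster among the $N$ vortices if there are a finite time $0<T_c<+\infty$ and a fixed point $\mathbf x^0\in\mathbb R^2$ such that, with $d_{jl}(t)=|\mathbf x_j(t)-\mathbf x_l(t)|$, one has $\min_{1\le j<l\le N}d_{jl}(t)>0$ for $0\le t<T_c$, $\lim_{t\to T_c^-}\mathbf x_j(t)=\mathbf x^0$ for all $j\in I$, and $\min_{j\in I}d_{jl}(t)>0$ for $0\le t\le T_c$ and every $l\in\{1,\dots,N\}\setminus I$. *)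

theory Defs
  imports "HOL-Analysis.Analysis" "HOL-Library.Landau_Symbols"
begin

definition unit_dir :: "real \<Rightarrow> real ^ 2" where
  "unit_dir \<phi> = vector [cos \<phi>, sin \<phi>]"

definition inner_angle :: "nat \<Rightarrow> real \<Rightarrow> nat \<Rightarrow> real" where
  "inner_angle n \<theta>\<^sub>0 j = 2 * (real j - 1) * pi / real n + \<theta>\<^sub>0"

definition outer_angle :: "nat \<Rightarrow> real \<Rightarrow> nat \<Rightarrow> real" where
  "outer_angle n \<theta>\<^sub>0 j = 2 * (real j - 1) * pi / real n + pi / real n + \<theta>\<^sub>0"

definition vortex_velocity :: "nat \<Rightarrow> (nat \<Rightarrow> int) \<Rightarrow> (nat \<Rightarrow> real ^ 2) \<Rightarrow> nat \<Rightarrow> real ^ 2" where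
  "vortex_velocity N m p j =
     (2 * of_int (m j)) *\<^sub>R
       (\<Sum>k\<in>{1..N} - {j}. (of_int (m k) / (norm (p j - p k))\<^sup>2) *\<^sub>R (p j - p k))"

text \<open>
  Vortices are numbered \<open>1, \<dots>, N\<close>.  A trajectory \<open>x\<close> is a total function of time, but only its
  values on the lifetime \<open>[0, T)\<close>, with \<open>T\<close> possibly infinite, are meaningful.  The right-hand
  side of the system is only defined at configurations without coinciding vortices, so a
  solution is required to be collision-free; Isabelle's division by zero plays no role.
\<close>

definition vortex_solution ::
    "nat \<Rightarrow> (nat \<Rightarrow> int) \<Rightarrow> (nat \<Rightarrow> real ^ 2) \<Rightarrow> ereal \<Rightarrow> (nat \<Rightarrow> real \<Rightarrow> real ^ 2) \<Rightarrow> bool" where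
  "vortex_solution N m y T x \<longleftrightarrow>
     0 < T \<and>
     (\<forall>j\<in>{1..N}. x j 0 = y j) \<and>
     (\<forall>j\<in>{1..N}. continuous_on {t. 0 \<le> t \<and> ereal t < T} (x j)) \<and>
     (\<forall>t. 0 \<le> t \<and> ereal t < T \<longrightarrow> (\<forall>j\<in>{1..N}. \<forall>l\<in>{1..N}. j \<noteq> l \<longrightarrow> x j t \<noteq> x l t)) \<and>
     (\<forall>t. 0 < t \<and> ereal t < T \<longrightarrow>
        (\<forall>j\<in>{1..N}. (x j has_vector_derivative vortex_velocity N m (\<lambda>k. x k t) j) (at t)))"

text \<open>
  \<open>x\<close> on \<open>[0, T)\<close> is the solution of the initial value problem: it is a solution, and every
  solution is a restriction of it (uniqueness and maximality of the lifetime \<open>T\<close>).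
\<close>

definition the_vortex_solution ::
    "nat \<Rightarrow> (nat \<Rightarrow> int) \<Rightarrow> (nat \<Rightarrow> real ^ 2) \<Rightarrow> ereal \<Rightarrow> (nat \<Rightarrow> real \<Rightarrow> real ^ 2) \<Rightarrow> bool" where
  "the_vortex_solution N m y T x \<longleftrightarrow>
     vortex_solution N m y T x \<and>
     (\<forall>T' x'. vortex_solution N m y T' x' \<longrightarrow>
        T' \<le> T \<and> (\<forall>j\<in>{1..N}. \<forall>t. 0 \<le> t \<and> ereal t < T' \<longrightarrow> x' j t = x j t))"

text \<open>
  Collision cluster \<open>I\<close> at time \<open>T\<^sub>c\<close> and point \<open>p\<close>, for a trajectory with lifetime \<open>[0, T)\<close>.
  The trajectory itself is not defined at the collision time, so the distance
  \<open>d\<^sub>j\<^sub>l(T\<^sub>c)\<close> between a vortex inside and one outside the cluster is its left limit there; that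
  the minimum over \<open>j \<in> I\<close> be positive means that each of these finitely many distances is.
\<close>

definition collision_cluster_at ::
    "nat \<Rightarrow> ereal \<Rightarrow> (nat \<Rightarrow> real \<Rightarrow> real ^ 2) \<Rightarrow> nat set \<Rightarrow> real \<Rightarrow> real ^ 2 \<Rightarrow> bool" where
  "collision_cluster_at N T x I T\<^sub>c p \<longleftrightarrow>
     I \<subseteq> {1..N} \<and> 2 \<le> card I \<and> 0 < T\<^sub>c \<and> ereal T\<^sub>c \<le> T \<and>
     (\<forall>t\<in>{0..<T\<^sub>c}. \<forall>j\<in>{1..N}. \<forall>l\<in>{1..N}. j \<noteq> l \<longrightarrow> 0 < dist (x j t) (x l t)) \<and>
     (\<forall>j\<in>I. (x j \<longlongrightarrow> p) (at_left T\<^sub>c)) \<and>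
     (\<forall>l\<in>{1..N} - I. \<forall>j\<in>I.
        (\<forall>t\<in>{0..<T\<^sub>c}. 0 < dist (x j t) (x l t)) \<and>
        (\<exists>d>0. ((\<lambda>t. dist (x j t) (x l t)) \<longlongrightarrow> d) (at_left T\<^sub>c)))"

definition collision_cluster ::
    "nat \<Rightarrow> ereal \<Rightarrow> (nat \<Rightarrow> real \<Rightarrow> real ^ 2) \<Rightarrow> nat set \<Rightarrow> bool" where
  "collision_cluster N T x I \<longleftrightarrow> (\<exists>T\<^sub>c p. collision_cluster_at N T x I T\<^sub>c p)"

end

theory Submission
  imports Defs
begin

text \<open>The statement asks for the unique maximal solution, whereas the reduction only exhibits
  one solution of two-ring shape. A competing solution need not share that symmetry, so uniqueness
  is proved for arbitrary systems of vortices. Maximality is then automatic for n >= 3, where the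
  radii exist for all time, and for n = 2 it is forced by the collision itself. The scalar equation
  is solved by separation of variables, after writing the trajectory as an exponential approach to
  the equilibrium. Existence for all time and convergence thus come out of one construction. The
  constant 2/5 does two things. The scalar field always vanishes at 1/2, the case of equal radii, so
  a negative value in between is needed to isolate the other zero z. And since the bound z < 2/5
  does not depend on n, the odds z / (1 - z) stay below 2/3, which makes the interaction term 4 n
  H(z) exponentially small in n. What remains is 2 n - 6 for the inner ring and, by the sum 8 n -
  12, the value 6 n - 6 for the outer one.\<close>

text \<open>
  Identify the plane with the complex numbers, so that the velocity of \<open>z\<^sub>j\<close> is a conjugated sum of
  terms \<open>m\<^sub>k / (z\<^sub>j - z\<^sub>k)\<close>.  For two concentric, interlaced regular \<open>n\<close>-gons these sums are sums over
  roots of unity and the velocities are radial.  Hence the system reduces to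
  \<open>\<rho>\<^sub>i' = 2 (n - 3) + 4 n \<rho>\<^sub>i\<^bsup>n/2\<^esup> / (\<rho>\<^sub>1\<^bsup>n/2\<^esup> + \<rho>\<^sub>2\<^bsup>n/2\<^esup>)\<close>, so \<open>S = \<rho>\<^sub>1 + \<rho>\<^sub>2\<close> grows with
  slope \<open>8 n - 12\<close>, and in the time \<open>ln S / (8 n - 12)\<close> the fraction \<open>\<rho>\<^sub>1 / S\<close> follows a scalar
  autonomous equation.  Its right-hand side is convex on \<open>(0, 1/2]\<close>; for \<open>n \<ge> 4\<close> it has exactly one
  zero inside \<open>(0, 1/2)\<close>, which attracts all solutions there and determines \<open>\<alpha>\<^sub>6\<close> and \<open>\<beta>\<^sub>6\<close>, and for
  \<open>n = 3\<close> the fraction tends to 0, while \<open>1 / \<surd>\<rho>\<^sub>1 - 1 / \<surd>\<rho>\<^sub>2\<close> is conserved.  For \<open>n = 2\<close> the equations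
  can be solved explicitly and \<open>\<rho>\<^sub>1\<close> vanishes in finite time.
\<close>

section \<open>Sums over roots of unity\<close>

definition unity_root :: "nat \<Rightarrow> nat \<Rightarrow> complex" where
  "unity_root n k = cis (2 * (real k - 1) * pi / real n)"

lemma unity_root_nonzero [simp]: "unity_root n k \<noteq> 0"
  by (simp add: unity_root_def)

lemma bij_betw_unity_root:
  assumes "n > 0"
  shows "bij_betw (unity_root n) {1..n} {z. z ^ n = 1}"
proof -
  have "bij_betw (\<lambda>k. k - 1) {1..n} {..<n}"
    by (rule bij_betwI[where g = Suc]) auto
  from bij_betw_trans[OF this Complex.bij_betw_roots_unity[OF assms]]
  show ?thesis
    by (rule bij_betw_cong[THEN iffD1, rotated]) (auto simp: unity_root_def o_def of_nat_diff algebra_simps)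
qed

text \<open>Multiplication by a primitive root \<open>\<omega>\<close> permutes the roots and
  multiplies the sum by \<open>\<omega> ^ i\<close>, which differs from 1 in the given range of
  \<open>i\<close>.\<close>

lemma sum_powers_roots_unity:
  assumes "0 < i" "i < n"
  shows "(\<Sum>\<zeta> | \<zeta> ^ n = 1. \<zeta> ^ i) = (0 :: complex)"
proof -
  define \<omega> where "\<omega> = cis (2 * pi / real n)"
  have "\<omega> ^ n = 1"
    using assms by (simp add: \<omega>_def Complex.DeMoivre)
  then have "\<omega> \<noteq> 0"
    using assms by (auto simp: power_0_left)
  have "inj_on (\<lambda>k. cis (2 * pi * real k / real n)) {..<n}"
    using Complex.bij_betw_roots_unity[of n] assms by (auto simp: bij_betw_def)
  from inj_onD[OF this, of i 0] have "cis (2 * pi * real i / real n) \<noteq> 1"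
    using assms by auto
  then have "\<omega> ^ i \<noteq> 1"
    by (simp add: \<omega>_def Complex.DeMoivre mult.commute)
  have "bij_betw ((*) \<omega>) {\<zeta>. \<zeta> ^ n = 1} {\<zeta>. \<zeta> ^ n = 1}"
    by (rule bij_betwI[where g = "\<lambda>\<zeta>. \<zeta> / \<omega>"])
      (use \<open>\<omega> ^ n = 1\<close> \<open>\<omega> \<noteq> 0\<close> in \<open>auto simp: power_mult_distrib power_divide\<close>)
  from sum.reindex_bij_betw[OF this, of "\<lambda>\<zeta>. \<zeta> ^ i"]
  have "\<omega> ^ i * (\<Sum>\<zeta> | \<zeta> ^ n = 1. \<zeta> ^ i) = (\<Sum>\<zeta> | \<zeta> ^ n = 1. \<zeta> ^ i)"
    by (simp add: power_mult_distrib sum_distrib_left)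
  with \<open>\<omega> ^ i \<noteq> 1\<close> show ?thesis
    by simp
qed

text \<open>The involution \<open>\<zeta> \<mapsto> 1 / \<zeta>\<close> pairs summands adding up to 1.\<close>

lemma sum_inverse_one_minus_roots_unity:
  assumes "n > 0"
  shows "(\<Sum>\<zeta>\<in>{\<zeta>. \<zeta> ^ n = 1} - {1}. 1 / (1 - \<zeta>)) = (of_nat n - 1) / (2 :: complex)"
proof -
  let ?R = "{\<zeta> :: complex. \<zeta> ^ n = 1} - {1}"
  have nz: "\<zeta> \<noteq> 0" if "\<zeta> \<in> ?R" for \<zeta>
    using that assms by (auto simp: power_0_left)
  have "bij_betw inverse ?R ?R"
    by (rule bij_betwI[where g = inverse]) (auto simp: power_inverse)
  from sum.reindex_bij_betw[OF this, of "\<lambda>\<zeta>. 1 / (1 - \<zeta>)"]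
  have "2 * (\<Sum>\<zeta>\<in>?R. 1 / (1 - \<zeta>)) = (\<Sum>\<zeta>\<in>?R. 1 / (1 - \<zeta>) + 1 / (1 - inverse \<zeta>))"
    by (simp add: sum.distrib)
  also have "\<dots> = (\<Sum>\<zeta>\<in>?R. 1)"
  proof (rule sum.cong[OF refl])
    fix \<zeta> assume "\<zeta> \<in> ?R"
    with nz show "1 / (1 - \<zeta>) + 1 / (1 - inverse \<zeta>) = 1"
      by (auto simp: divide_simps) (simp add: algebra_simps)
  qed
  also have "\<dots> = of_nat n - 1"
    using assms card_roots_unity_eq[of n] finite_roots_unity[of n, where ?'a = complex]
    by (simp add: card_Diff_singleton of_nat_diff)
  finally show ?thesis
    by (simp add: eq_divide_eq mult.commute)
qed

text \<open>Dividing by the root with index \<open>j\<close> permutes the roots of unity and moves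
  that root to 1, which reduces the sum to the previous one.\<close>

lemma sum_inverse_diff_same_ring:
  assumes "A \<noteq> 0" "j \<in> {1..n}"
  shows "(\<Sum>k\<in>{1..n} - {j}. 1 / (A * unity_root n j - A * unity_root n k)) =
    (of_nat n - 1) / (2 * (A * unity_root n j))"
proof -
  have "n > 0"
    using assms by auto
  let ?z = "unity_root n"
  let ?R = "{\<zeta> :: complex. \<zeta> ^ n = 1}"
  have bij: "bij_betw ?z {1..n} ?R"
    using \<open>n > 0\<close> by (rule bij_betw_unity_root)
  have "?z j ^ n = 1"
    using bij assms by (auto simp: bij_betw_def)
  have "bij_betw (\<lambda>\<zeta>. \<zeta> / ?z j) ?R ?R"
    by (rule bij_betwI[where g = "\<lambda>\<zeta>. \<zeta> * ?z j"])
      (use \<open>?z j ^ n = 1\<close> in \<open>auto simp: power_mult_distrib power_divide\<close>)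
  from bij_betw_trans[OF bij this]
  have "bij_betw (\<lambda>k. ?z k / ?z j) {1..n} ?R"
    by (simp add: o_def)
  then have "bij_betw (\<lambda>k. ?z k / ?z j) ({1..n} - {j}) (?R - {1})"
    using assms bij_betw_DiffI[of _ "{1..n}" ?R "{j}" "{1}"] by (simp add: bij_betw_def)
  from sum.reindex_bij_betw[OF this, of "\<lambda>\<zeta>. 1 / (1 - \<zeta>)"]
  have "(\<Sum>k\<in>{1..n} - {j}. 1 / (1 - ?z k / ?z j)) = (of_nat n - 1) / 2"
    using sum_inverse_one_minus_roots_unity[OF \<open>n > 0\<close>] by simp
  moreover have "1 / (A * ?z j - A * ?z k) = 1 / (A * ?z j) * (1 / (1 - ?z k / ?z j))" for k
    using assms by (simp add: divide_simps) (simp add: algebra_simps)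
  ultimately show ?thesis
    by (simp only: sum_distrib_left[symmetric]) simp
qed

text \<open>
  The summand is \<open>(\<Sum>i<n. z ^ (n - 1 - i) * w ^ i) / (z ^ n - w ^ n)\<close> with a common denominator, and
  only the power sum for \<open>i = 0\<close> does not vanish.
\<close>

lemma sum_inverse_diff_other_ring:
  assumes "n > 0" "z ^ n \<noteq> B ^ n"
  shows "(\<Sum>k\<in>{1..n}. 1 / (z - B * unity_root n k)) = of_nat n * z ^ (n - 1) / (z ^ n - B ^ n)"
proof -
  let ?R = "{\<zeta> :: complex. \<zeta> ^ n = 1}"
  have "(\<Sum>k\<in>{1..n}. 1 / (z - B * unity_root n k)) = (\<Sum>\<zeta>\<in>?R. 1 / (z - B * \<zeta>))"
    using bij_betw_unity_root[OF assms(1)] by (rule sum.reindex_bij_betw)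
  also have "\<dots> = (\<Sum>\<zeta>\<in>?R. (\<Sum>i<n. z ^ (n - Suc i) * (B * \<zeta>) ^ i) / (z ^ n - B ^ n))"
  proof (rule sum.cong[OF refl])
    fix \<zeta> assume "\<zeta> \<in> ?R"
    then have eq: "z ^ n - B ^ n = z ^ n - (B * \<zeta>) ^ n"
      by (simp add: power_mult_distrib)
    then have "z \<noteq> B * \<zeta>"
      using assms by auto
    define S where "S = (\<Sum>i<n. z ^ (n - Suc i) * (B * \<zeta>) ^ i)"
    have "z ^ n - B ^ n = (z - B * \<zeta>) * S"
      using power_diff_sumr2[of "B * \<zeta>" n z] unfolding eq S_def by (simp add: algebra_simps)
    moreover from this have "S \<noteq> 0"
      using assms(2) by auto
    ultimately show "1 / (z - B * \<zeta>) = S / (z ^ n - B ^ n)"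
      using \<open>z \<noteq> B * \<zeta>\<close> by simp
  qed
  also have "\<dots> = (\<Sum>i<n. z ^ (n - Suc i) * B ^ i * (\<Sum>\<zeta>\<in>?R. \<zeta> ^ i)) / (z ^ n - B ^ n)"
    unfolding sum_divide_distrib[symmetric]
    by (subst sum.swap) (simp add: sum_distrib_left power_mult_distrib mult.assoc)
  also have "(\<Sum>i<n. z ^ (n - Suc i) * B ^ i * (\<Sum>\<zeta>\<in>?R. \<zeta> ^ i)) =
      (\<Sum>i<n. if i = 0 then z ^ (n - 1) * of_nat n else 0)"
    by (intro sum.cong refl)
      (use sum_powers_roots_unity card_roots_unity_eq[OF assms(1)] in auto)
  also have "\<dots> = of_nat n * z ^ (n - 1)"
    using assms(1) by simp
  finally show ?thesis .
qed

section \<open>Velocities of the two-ring configuration\<close>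

definition vec_of_complex :: "complex \<Rightarrow> real ^ 2" where
  "vec_of_complex z = vector [Re z, Im z]"

lemma linear_vec_of_complex: "linear vec_of_complex"
  by (rule linearI) (simp_all add: vec_of_complex_def vec_eq_iff forall_2)

lemmas vec_of_complex_simps =
  linear_add[OF linear_vec_of_complex] linear_diff[OF linear_vec_of_complex]
  linear_sum[OF linear_vec_of_complex] linear_scale[OF linear_vec_of_complex]
  linear_0[OF linear_vec_of_complex]

lemma vec_of_complex_of_real_mult: "vec_of_complex (of_real c * z) = c *\<^sub>R vec_of_complex z"
  unfolding scaleR_conv_of_real[symmetric] by (rule linear_scale[OF linear_vec_of_complex])

lemma norm_vec_of_complex: "norm (vec_of_complex z) = cmod z"
  by (simp add: norm_vec_def L2_set_def sum_2 vec_of_complex_def cmod_def)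

lemma unit_dir_eq: "unit_dir \<phi> = vec_of_complex (cis \<phi>)"
  by (simp add: unit_dir_def vec_of_complex_def)

lemma norm_unit_dir [simp]: "norm (unit_dir \<phi>) = 1"
  by (simp add: unit_dir_eq norm_vec_of_complex)

text \<open>
  Since \<open>z / \<bar>z\<bar>\<^sup>2 = cnj (1 / z)\<close>, the velocity is a conjugated sum of simple fractions; the junk
  value \<open>1 / 0 = 0\<close> allows the self-interaction to be included in the sum.
\<close>

lemma vortex_velocity_complex:
  "vortex_velocity N m (\<lambda>k. vec_of_complex (z k)) j =
     vec_of_complex (2 * of_int (m j) * cnj (\<Sum>k\<in>{1..N}. of_int (m k) * (1 / (z j - z k))))"
proof -
  have "(of_int (m k) / (norm (vec_of_complex (z j) - vec_of_complex (z k)))\<^sup>2) *\<^sub>R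
      (vec_of_complex (z j) - vec_of_complex (z k)) =
      vec_of_complex (cnj (of_int (m k) * (1 / (z j - z k))))" for k
  proof -
    define w where "w = z j - z k"
    have "cnj (1 / w) = w /\<^sub>R (cmod w)\<^sup>2"
      using complex_div_cnj[of 1 w] by (simp add: scaleR_conv_of_real divide_inverse)
    then have "cnj (of_int (m k) * (1 / w)) = (of_int (m k) / (cmod w)\<^sup>2) *\<^sub>R w"
      by (simp add: scaleR_conv_of_real divide_inverse mult.assoc)
    then show ?thesis
      by (simp add: w_def vec_of_complex_simps[symmetric] norm_vec_of_complex)
  qed
  then have "vortex_velocity N m (\<lambda>k. vec_of_complex (z k)) j = (2 * of_int (m j)) *\<^sub>R
      vec_of_complex (\<Sum>k\<in>{1..N} - {j}. cnj (of_int (m k) * (1 / (z j - z k))))"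
    by (simp add: vortex_velocity_def vec_of_complex_simps)
  also have "(\<Sum>k\<in>{1..N} - {j}. cnj (of_int (m k) * (1 / (z j - z k)))) =
      cnj (\<Sum>k\<in>{1..N}. of_int (m k) * (1 / (z j - z k)))"
    unfolding cnj_sum by (rule sum.mono_neutral_left) auto
  finally show ?thesis
    using vec_of_complex_of_real_mult[of "2 * of_int (m j)"] by simp
qed

definition two_ring :: "nat \<Rightarrow> real \<Rightarrow> real \<Rightarrow> real \<Rightarrow> nat \<Rightarrow> real ^ 2" where
  "two_ring n \<theta> r\<^sub>1 r\<^sub>2 k =
     (if k \<le> n then r\<^sub>1 *\<^sub>R unit_dir (inner_angle n \<theta> k)
      else if k \<le> 2 * n then r\<^sub>2 *\<^sub>R unit_dir (outer_angle n \<theta> (k - n)) else 0)"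

text \<open>This is the factor left over when the pull of the other ring is summed in closed form.
  The plus sign in the denominator reflects the interlacing: the half-step rotation flips the sign
  of one \<open>n\<close>-th power.\<close>

definition ring_share :: "nat \<Rightarrow> real \<Rightarrow> real \<Rightarrow> real" where
  "ring_share n r s = r ^ n / (r ^ n + s ^ n)"

lemma sum_two_rings:
  fixes f :: "nat \<Rightarrow> 'a::comm_monoid_add"
  shows "(\<Sum>k\<in>{1..2 * n + 1}. f k) = (\<Sum>k\<in>{1..n}. f k) + (\<Sum>k\<in>{1..n}. f (n + k)) + f (2 * n + 1)"
proof -
  have "(\<Sum>k\<in>{1..n + n}. f k) = (\<Sum>k\<in>{1..n}. f k) + (\<Sum>k\<in>{n + 1..n + n}. f k)"
    by (rule sum.ub_add_nat) simp
  also have "(\<Sum>k\<in>{n + 1..n + n}. f k) = (\<Sum>k\<in>{1..n}. f (n + k))"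
    using sum.shift_bounds_cl_nat_ivl[of f 1 n n] by (simp add: add.commute)
  finally show ?thesis
    by (simp add: mult_2)
qed

context
  fixes n :: nat and \<theta> r\<^sub>1 r\<^sub>2 :: real and m\<^sub>0 :: int and m :: "nat \<Rightarrow> int"
  assumes n: "n \<ge> 2" and r: "0 < r\<^sub>1" "0 < r\<^sub>2"
    and m\<^sub>0: "m\<^sub>0 = 1 \<or> m\<^sub>0 = -1"
    and m: "m (2 * n + 1) = - m\<^sub>0" "\<forall>j\<in>{1..2 * n}. m j = m\<^sub>0"
begin

private definition "A = r\<^sub>1 * cis \<theta>"
private definition "B = r\<^sub>2 * cis (\<theta> + pi / n)"
private definition "z k = (if k \<le> n then A * unity_root n k
  else if k \<le> 2 * n then B * unity_root n (k - n) else 0)" for k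

private lemma two_ring_eq: "two_ring n \<theta> r\<^sub>1 r\<^sub>2 k = vec_of_complex (z k)"
proof -
  have "cis (inner_angle n \<theta> j) = cis \<theta> * unity_root n j"
    "cis (outer_angle n \<theta> j) = cis (\<theta> + pi / n) * unity_root n j" for j
    by (simp_all add: inner_angle_def outer_angle_def unity_root_def cis_mult algebra_simps)
  then show ?thesis
    by (simp add: two_ring_def z_def A_def B_def unit_dir_eq vec_of_complex_of_real_mult
        vec_of_complex_simps mult.assoc)
qed

text \<open>The offset \<open>pi / n\<close> between the rings becomes \<open>pi\<close> in the
  \<open>n\<close>-th power, hence the sign. It keeps \<open>A ^ n - B ^ n\<close> away from zero
  for all positive radii.\<close>

private lemma powers: "A ^ n = r\<^sub>1 ^ n * cis (n * \<theta>)" "B ^ n = - (r\<^sub>2 ^ n * cis (n * \<theta>))"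
proof -
  have "real n * (\<theta> + pi / n) = n * \<theta> + pi"
    using n by (simp add: field_simps)
  then have "cis (n * (\<theta> + pi / n)) = - cis (n * \<theta>)"
    by (simp add: cis_mult[symmetric])
  then show "A ^ n = r\<^sub>1 ^ n * cis (n * \<theta>)" "B ^ n = - (r\<^sub>2 ^ n * cis (n * \<theta>))"
    by (simp_all add: A_def B_def power_mult_distrib Complex.DeMoivre)
qed

private lemma powers_ne: "A ^ n \<noteq> 0" "B ^ n \<noteq> 0" "A ^ n \<noteq> B ^ n" "A ^ n - B ^ n \<noteq> 0"
proof -
  have "complex_of_real (r\<^sub>1 ^ n + r\<^sub>2 ^ n) \<noteq> 0"
    using r by (metis add_pos_pos less_irrefl of_real_eq_0_iff zero_less_power)
  then have *: "complex_of_real r\<^sub>1 ^ n + complex_of_real r\<^sub>2 ^ n \<noteq> 0"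
    by simp
  have "A ^ n - B ^ n = (complex_of_real r\<^sub>1 ^ n + complex_of_real r\<^sub>2 ^ n) * cis (n * \<theta>)"
    by (simp add: powers algebra_simps)
  then show "A ^ n - B ^ n \<noteq> 0"
    using * by simp
  then show "A ^ n \<noteq> B ^ n"
    by simp
  show "A ^ n \<noteq> 0" "B ^ n \<noteq> 0"
    using r by (simp_all add: powers)
qed

private lemma unity_root_power: "j \<in> {1..n} \<Longrightarrow> unity_root n j ^ n = 1"
  using bij_betw_unity_root[of n] n by (auto simp: bij_betw_def)

private lemma shares:
  "A ^ n / (A ^ n - B ^ n) = ring_share n r\<^sub>1 r\<^sub>2" "B ^ n / (B ^ n - A ^ n) = ring_share n r\<^sub>2 r\<^sub>1"
proof -
  have "A ^ n - B ^ n = of_real (r\<^sub>1 ^ n + r\<^sub>2 ^ n) * cis (n * \<theta>)"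
    "B ^ n - A ^ n = - (of_real (r\<^sub>2 ^ n + r\<^sub>1 ^ n) * cis (n * \<theta>))"
    by (simp_all add: powers algebra_simps)
  then show "A ^ n / (A ^ n - B ^ n) = ring_share n r\<^sub>1 r\<^sub>2"
    "B ^ n / (B ^ n - A ^ n) = ring_share n r\<^sub>2 r\<^sub>1"
    by (simp_all add: powers ring_share_def)
qed

private lemma sum_z:
  "(\<Sum>k\<in>{1..2 * n + 1}. of_int (m k) * (1 / (w - z k))) =
     of_int m\<^sub>0 * ((\<Sum>k\<in>{1..n}. 1 / (w - A * unity_root n k)) +
       (\<Sum>k\<in>{1..n}. 1 / (w - B * unity_root n k)) - 1 / w)" (is "_ = of_int m\<^sub>0 * ?S")
proof -
  have "(\<Sum>k\<in>{1..n}. of_int (m k) * (1 / (w - z k))) =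
      (\<Sum>k\<in>{1..n}. of_int m\<^sub>0 * (1 / (w - A * unity_root n k)))"
    by (intro sum.cong refl) (simp add: z_def m)
  moreover have "(\<Sum>k\<in>{1..n}. of_int (m (n + k)) * (1 / (w - z (n + k)))) =
      (\<Sum>k\<in>{1..n}. of_int m\<^sub>0 * (1 / (w - B * unity_root n k)))"
    by (intro sum.cong refl) (simp add: z_def m)
  ultimately show ?thesis
    unfolding sum_two_rings sum_distrib_left[symmetric]
    using m(1) by (simp add: z_def right_diff_distrib distrib_left)
qed

private lemma sum_same_ring:
  assumes "C \<noteq> 0" "j \<in> {1..n}"
  shows "(\<Sum>k\<in>{1..n}. 1 / (C * unity_root n j - C * unity_root n k)) =
    (of_nat n - 1) / (2 * (C * unity_root n j))"
  unfolding sum_inverse_diff_same_ring[OF assms, symmetric]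
  by (rule sum.mono_neutral_right) auto

text \<open>A ring vortex has winding number \<open>m\<^sub>0\<close>, so the two signs multiply to
  1. As \<open>c\<close> is real, the conjugate of \<open>c / p\<close> is a real multiple of
  \<open>p\<close>, that is, the velocity is radial.\<close>

private lemma velocity_from_sum:
  assumes "p \<noteq> 0" "j \<le> 2 * n" "1 \<le> j" "z j = p"
    and "(\<Sum>k\<in>{1..n}. 1 / (p - A * unity_root n k)) +
       (\<Sum>k\<in>{1..n}. 1 / (p - B * unity_root n k)) - 1 / p = of_real c / p"
  shows "vortex_velocity (2 * n + 1) m (two_ring n \<theta> r\<^sub>1 r\<^sub>2) j =
    (2 * c / (norm (two_ring n \<theta> r\<^sub>1 r\<^sub>2 j))\<^sup>2) *\<^sub>R two_ring n \<theta> r\<^sub>1 r\<^sub>2 j"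
proof -
  have "of_int m\<^sub>0 * of_int m\<^sub>0 = (1 :: complex)"
    using m\<^sub>0 by auto
  then have "2 * of_int (m j) * cnj (of_int m\<^sub>0 * (of_real c / p)) = 2 * of_real c * cnj (1 / p)"
    using assms m by simp
  also have "\<dots> = (2 * c / (cmod p)\<^sup>2) *\<^sub>R p"
    using complex_div_cnj[of 1 p] by (simp add: scaleR_conv_of_real divide_inverse)
  finally have "2 * of_int (m j) * cnj (\<Sum>k\<in>{1..2 * n + 1}. of_int (m k) * (1 / (z j - z k))) =
      (2 * c / (cmod p)\<^sup>2) *\<^sub>R p"
    using assms by (simp only: sum_z)
  then show ?thesis
    using vortex_velocity_complex[of "2 * n + 1" m z j] assms
    by (simp add: two_ring_eq[abs_def] norm_vec_of_complex vec_of_complex_simps)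
qed

lemma velocity_center: "vortex_velocity (2 * n + 1) m (two_ring n \<theta> r\<^sub>1 r\<^sub>2) (2 * n + 1) = 0"
proof -
  \<comment> \<open>At the origin the closed form carries the factor \<open>0 ^ (n - 1)\<close>,
    which vanishes because \<open>n \<ge> 2\<close>.\<close>
  have *: "(\<Sum>k\<in>{1..n}. 1 / (0 - C * unity_root n k)) = 0" if "C ^ n \<noteq> 0" for C
    using sum_inverse_diff_other_ring[of n 0 C] n that by (simp add: power_0_left)
  have "z (2 * n + 1) = 0"
    by (simp add: z_def)
  then have "(\<Sum>k\<in>{1..2 * n + 1}. of_int (m k) * (1 / (z (2 * n + 1) - z k))) = 0"
    by (simp only: sum_z *[OF powers_ne(1)] *[OF powers_ne(2)]) simp
  then show ?thesis
    using vortex_velocity_complex[of "2 * n + 1" m z "2 * n + 1"]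
    by (simp add: two_ring_eq[abs_def] vec_of_complex_simps)
qed

lemma velocity_inner:
  assumes "j \<in> {1..n}"
  shows "vortex_velocity (2 * n + 1) m (two_ring n \<theta> r\<^sub>1 r\<^sub>2) j =
    ((real n - 3 + 2 * real n * ring_share n r\<^sub>1 r\<^sub>2) / r\<^sub>1) *\<^sub>R unit_dir (inner_angle n \<theta> j)"
proof -
  define p where "p = A * unity_root n j"
  have "p ^ n = A ^ n"
    using assms by (simp add: p_def power_mult_distrib unity_root_power)
  then have "p \<noteq> 0"
    using powers_ne(1) n by (auto simp: power_0_left)
  have "A \<noteq> 0"
    using r by (simp add: A_def)
  have "p * p ^ (n - 1) = A ^ n"
    using \<open>p ^ n = A ^ n\<close> n by (simp add: power_Suc[symmetric])
  then have *: "p ^ (n - 1) / (A ^ n - B ^ n) = ring_share n r\<^sub>1 r\<^sub>2 / p"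
    unfolding shares(1)[symmetric] using \<open>p \<noteq> 0\<close> by (simp flip: \<open>p * p ^ (n - 1) = A ^ n\<close>)
  \<comment> \<open>The own ring contributes \<open>(n - 1) / 2\<close> and the centre of opposite
    sign \<open>-1\<close>, together \<open>(n - 3) / 2\<close>; the other ring contributes
    \<open>n\<close> times its share.\<close>
  define c where "c = (real n - 3) / 2 + n * ring_share n r\<^sub>1 r\<^sub>2"
  have sum: "(\<Sum>k\<in>{1..n}. 1 / (p - A * unity_root n k)) +
      (\<Sum>k\<in>{1..n}. 1 / (p - B * unity_root n k)) - 1 / p = of_real c / p"
  proof -
    have "(\<Sum>k\<in>{1..n}. 1 / (p - A * unity_root n k)) = (of_nat n - 1) / (2 * p)"
      unfolding p_def by (rule sum_same_ring[OF \<open>A \<noteq> 0\<close> assms])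
    moreover have "(\<Sum>k\<in>{1..n}. 1 / (p - B * unity_root n k)) = n * (ring_share n r\<^sub>1 r\<^sub>2 / p)"
      using sum_inverse_diff_other_ring[of n p B] powers_ne(3) n
      unfolding *[symmetric] \<open>p ^ n = A ^ n\<close> by simp
    ultimately show ?thesis
      using \<open>p \<noteq> 0\<close> by (simp add: c_def diff_divide_distrib add_divide_distrib divide_divide_eq_left)
  qed
  have "vortex_velocity (2 * n + 1) m (two_ring n \<theta> r\<^sub>1 r\<^sub>2) j =
      (2 * c / (norm (two_ring n \<theta> r\<^sub>1 r\<^sub>2 j))\<^sup>2) *\<^sub>R two_ring n \<theta> r\<^sub>1 r\<^sub>2 j"
    using \<open>p \<noteq> 0\<close> _ _ _ sum by (rule velocity_from_sum) (use assms in \<open>auto simp: z_def p_def\<close>)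
  also have "two_ring n \<theta> r\<^sub>1 r\<^sub>2 j = r\<^sub>1 *\<^sub>R unit_dir (inner_angle n \<theta> j)"
    using assms by (simp add: two_ring_def)
  also have "(2 * c / (norm (r\<^sub>1 *\<^sub>R unit_dir (inner_angle n \<theta> j)))\<^sup>2) *\<^sub>R (r\<^sub>1 *\<^sub>R unit_dir (inner_angle n \<theta> j)) =
      (2 * c / r\<^sub>1) *\<^sub>R unit_dir (inner_angle n \<theta> j)"
    using r by (simp add: power2_eq_square)
  finally show ?thesis
    by (simp add: c_def distrib_left)
qed

lemma velocity_outer:
  assumes "j \<in> {1..n}"
  shows "vortex_velocity (2 * n + 1) m (two_ring n \<theta> r\<^sub>1 r\<^sub>2) (n + j) =
    ((real n - 3 + 2 * real n * ring_share n r\<^sub>2 r\<^sub>1) / r\<^sub>2) *\<^sub>R unit_dir (outer_angle n \<theta> j)"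
proof -
  define p where "p = B * unity_root n j"
  have "p ^ n = B ^ n"
    using assms by (simp add: p_def power_mult_distrib unity_root_power)
  then have "p \<noteq> 0"
    using powers_ne(2) n by (auto simp: power_0_left)
  have "B \<noteq> 0"
    using r by (simp add: B_def)
  have "p * p ^ (n - 1) = B ^ n"
    using \<open>p ^ n = B ^ n\<close> n by (simp add: power_Suc[symmetric])
  then have *: "p ^ (n - 1) / (B ^ n - A ^ n) = ring_share n r\<^sub>2 r\<^sub>1 / p"
    unfolding shares(2)[symmetric] using \<open>p \<noteq> 0\<close> by (simp flip: \<open>p * p ^ (n - 1) = B ^ n\<close>)
  define c where "c = (real n - 3) / 2 + n * ring_share n r\<^sub>2 r\<^sub>1"
  have sum: "(\<Sum>k\<in>{1..n}. 1 / (p - A * unity_root n k)) +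
      (\<Sum>k\<in>{1..n}. 1 / (p - B * unity_root n k)) - 1 / p = of_real c / p"
  proof -
    have "(\<Sum>k\<in>{1..n}. 1 / (p - B * unity_root n k)) = (of_nat n - 1) / (2 * p)"
      unfolding p_def by (rule sum_same_ring[OF \<open>B \<noteq> 0\<close> assms])
    moreover have "(\<Sum>k\<in>{1..n}. 1 / (p - A * unity_root n k)) = n * (ring_share n r\<^sub>2 r\<^sub>1 / p)"
      using sum_inverse_diff_other_ring[of n p A] powers_ne(3) n
      unfolding *[symmetric] \<open>p ^ n = B ^ n\<close> by simp
    ultimately show ?thesis
      using \<open>p \<noteq> 0\<close> by (simp add: c_def diff_divide_distrib add_divide_distrib divide_divide_eq_left)
  qed
  have "vortex_velocity (2 * n + 1) m (two_ring n \<theta> r\<^sub>1 r\<^sub>2) (n + j) =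
      (2 * c / (norm (two_ring n \<theta> r\<^sub>1 r\<^sub>2 (n + j)))\<^sup>2) *\<^sub>R two_ring n \<theta> r\<^sub>1 r\<^sub>2 (n + j)"
    using \<open>p \<noteq> 0\<close> _ _ _ sum by (rule velocity_from_sum) (use assms in \<open>auto simp: z_def p_def\<close>)
  also have "two_ring n \<theta> r\<^sub>1 r\<^sub>2 (n + j) = r\<^sub>2 *\<^sub>R unit_dir (outer_angle n \<theta> j)"
    using assms by (simp add: two_ring_def)
  also have "(2 * c / (norm (r\<^sub>2 *\<^sub>R unit_dir (outer_angle n \<theta> j)))\<^sup>2) *\<^sub>R (r\<^sub>2 *\<^sub>R unit_dir (outer_angle n \<theta> j)) =
      (2 * c / r\<^sub>2) *\<^sub>R unit_dir (outer_angle n \<theta> j)"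
    using r by (simp add: power2_eq_square)
  finally show ?thesis
    by (simp add: c_def distrib_left)
qed

end

section \<open>Uniqueness of solutions\<close>

text \<open>The interaction kernel is inversion in the unit sphere. This classical distance formula
  yields its Lipschitz constant away from the origin.\<close>

lemma norm_inversion_diff:
  fixes p q :: "'a::real_inner"
  assumes "p \<noteq> 0" "q \<noteq> 0"
  shows "norm (p /\<^sub>R (norm p)\<^sup>2 - q /\<^sub>R (norm q)\<^sup>2) = norm (p - q) / (norm p * norm q)"
proof (rule power2_eq_imp_eq)
  have polar: "(norm (a - b))\<^sup>2 = a \<bullet> a + b \<bullet> b - 2 * (a \<bullet> b)" for a b :: 'a
    by (simp add: power2_norm_eq_inner inner_diff inner_commute)
  have "(norm (p /\<^sub>R (norm p)\<^sup>2 - q /\<^sub>R (norm q)\<^sup>2))\<^sup>2 =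
      (norm p)\<^sup>2 / (norm p)^4 + (norm q)\<^sup>2 / (norm q)^4 - 2 * (p \<bullet> q) / ((norm p)\<^sup>2 * (norm q)\<^sup>2)"
    unfolding polar
    by (simp add: power2_norm_eq_inner[symmetric] divide_inverse power2_eq_square power4_eq_xxxx mult_ac)
  also have "\<dots> = ((norm p)\<^sup>2 + (norm q)\<^sup>2 - 2 * (p \<bullet> q)) / ((norm p)\<^sup>2 * (norm q)\<^sup>2)"
    using assms by (simp add: field_simps power4_eq_xxxx power2_eq_square)
  also have "(norm p)\<^sup>2 + (norm q)\<^sup>2 - 2 * (p \<bullet> q) = (norm (p - q))\<^sup>2"
    by (simp only: polar) (simp only: power2_norm_eq_inner)
  finally show "(norm (p /\<^sub>R (norm p)\<^sup>2 - q /\<^sub>R (norm q)\<^sup>2))\<^sup>2 =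
      (norm (p - q) / (norm p * norm q))\<^sup>2"
    by (simp add: power_divide power_mult_distrib)
qed auto

lemma norm_inversion_diff_le:
  fixes p q :: "'a::real_inner"
  assumes "0 < \<delta>" "\<delta> \<le> norm p" "\<delta> \<le> norm q"
  shows "norm (p /\<^sub>R (norm p)\<^sup>2 - q /\<^sub>R (norm q)\<^sup>2) \<le> norm (p - q) / \<delta>\<^sup>2"
proof -
  have "p \<noteq> 0" "q \<noteq> 0"
    using assms by auto
  moreover have "\<delta>\<^sup>2 \<le> norm p * norm q"
    using assms by (simp add: power2_eq_square mult_mono)
  ultimately show ?thesis
    using assms by (simp add: norm_inversion_diff divide_left_mono)
qed

text \<open>Uniqueness must exclude competitors without any symmetry, so the estimate covers
  arbitrary separated configurations. Each pair difference is off by at most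
  \<open>2 * \<epsilon>\<close>, and the inverted difference by that over
  \<open>\<delta>\<^sup>2\<close>.\<close>

lemma vortex_velocity_Lipschitz:
  fixes m :: "nat \<Rightarrow> int"
  assumes "0 < \<delta>"
    and sep: "\<And>j k. j \<in> {1..N} \<Longrightarrow> k \<in> {1..N} \<Longrightarrow> j \<noteq> k \<Longrightarrow>
      \<delta> \<le> norm (p j - p k) \<and> \<delta> \<le> norm (q j - q k)"
    and err: "\<And>j. j \<in> {1..N} \<Longrightarrow> norm (p j - q j) \<le> \<epsilon>"
    and j: "j \<in> {1..N}"
  defines "W \<equiv> (\<Sum>k\<in>{1..N}. \<bar>real_of_int (m k)\<bar>)"
  shows "norm (vortex_velocity N m p j - vortex_velocity N m q j) \<le> 4 * W\<^sup>2 / \<delta>\<^sup>2 * \<epsilon>"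
proof -
  have "0 \<le> \<epsilon>"
    using err[OF j] norm_ge_zero order_trans by blast
  let ?J = "\<lambda>w. w /\<^sub>R (norm w)\<^sup>2"
  have eq: "vortex_velocity N m p j - vortex_velocity N m q j =
      (2 * of_int (m j)) *\<^sub>R (\<Sum>k\<in>{1..N} - {j}. of_int (m k) *\<^sub>R (?J (p j - p k) - ?J (q j - q k)))"
    by (simp add: vortex_velocity_def sum_subtractf scaleR_diff_right divide_inverse)
  have "norm (vortex_velocity N m p j - vortex_velocity N m q j) = (2 * \<bar>of_int (m j)\<bar>) *
      norm (\<Sum>k\<in>{1..N} - {j}. of_int (m k) *\<^sub>R (?J (p j - p k) - ?J (q j - q k)))"
    unfolding eq norm_scaleR by (simp only: abs_mult abs_numeral)
  also have "\<dots> \<le> (2 * \<bar>of_int (m j)\<bar>) *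
      (\<Sum>k\<in>{1..N} - {j}. \<bar>of_int (m k)\<bar> * (2 * \<epsilon> / \<delta>\<^sup>2))"
  proof (rule mult_left_mono, rule sum_norm_le)
    fix k assume k: "k \<in> {1..N} - {j}"
    then have "j \<noteq> k" "k \<in> {1..N}"
      by auto
    then have "\<delta> \<le> norm (p j - p k)" "\<delta> \<le> norm (q j - q k)"
      using sep[OF j] by blast+
    then have "norm (?J (p j - p k) - ?J (q j - q k)) \<le> norm ((p j - p k) - (q j - q k)) / \<delta>\<^sup>2"
      by (rule norm_inversion_diff_le[OF assms(1)])
    also have "norm ((p j - p k) - (q j - q k)) \<le> norm (p j - q j) + norm (p k - q k)"
      using norm_triangle_ineq4[of "p j - q j" "p k - q k"] by (simp add: algebra_simps)
    also have "\<dots> \<le> 2 * \<epsilon>"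
      using err[OF j] err[OF \<open>k \<in> {1..N}\<close>] by linarith
    finally have "norm (?J (p j - p k) - ?J (q j - q k)) \<le> 2 * \<epsilon> / \<delta>\<^sup>2"
      by (simp add: divide_right_mono)
    then show "norm (of_int (m k) *\<^sub>R (?J (p j - p k) - ?J (q j - q k))) \<le>
        \<bar>of_int (m k)\<bar> * (2 * \<epsilon> / \<delta>\<^sup>2)"
      unfolding norm_scaleR real_norm_def by (rule mult_left_mono) simp
  qed auto
  also have "\<dots> \<le> (2 * W) * (W * (2 * \<epsilon> / \<delta>\<^sup>2))"
  proof (rule mult_mono)
    show "2 * \<bar>of_int (m j)\<bar> \<le> 2 * W"
      using j member_le_sum[of j "{1..N}" "\<lambda>k. \<bar>real_of_int (m k)\<bar>"] by (simp add: W_def)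
    have "(\<Sum>k\<in>{1..N} - {j}. \<bar>real_of_int (m k)\<bar>) \<le> W"
      unfolding W_def by (rule sum_mono2) auto
    then show "(\<Sum>k\<in>{1..N} - {j}. \<bar>of_int (m k)\<bar> * (2 * \<epsilon> / \<delta>\<^sup>2)) \<le> W * (2 * \<epsilon> / \<delta>\<^sup>2)"
      unfolding sum_distrib_right[symmetric] using \<open>0 \<le> \<epsilon>\<close> by (intro mult_right_mono) auto
  qed (use \<open>0 \<le> \<epsilon>\<close> in \<open>auto intro!: sum_nonneg simp: W_def\<close>)
  also have "\<dots> = 4 * W\<^sup>2 / \<delta>\<^sup>2 * \<epsilon>"
    by (simp add: power2_eq_square)
  finally show ?thesis .
qed

section \<open>Separation on compact time intervals and comparison of two solutions\<close>

lemma ereal_le_less_trans: "s \<le> t \<Longrightarrow> ereal t < T \<Longrightarrow> ereal s < T"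
  by (rule le_less_trans[of _ "ereal t"]) simp_all

lemma vortex_solution_continuous_on:
  assumes "vortex_solution N m y T x" "ereal t < T" "j \<in> {1..N}"
  shows "continuous_on {0..t} (x j)"
proof (rule continuous_on_subset)
  show "continuous_on {s. 0 \<le> s \<and> ereal s < T} (x j)"
    using assms by (simp add: vortex_solution_def)
  show "{0..t} \<subseteq> {s. 0 \<le> s \<and> ereal s < T}"
    using assms(2) ereal_le_less_trans by auto
qed

text \<open>Compactness of the time interval: each of the finitely many distances is continuous and
  positive, so it attains a positive minimum. This keeps a solution in a region where the velocity
  is Lipschitz.\<close>

lemma vortex_solution_separated:
  assumes "vortex_solution N m y T x" "ereal t < T"
  shows "\<exists>\<delta>>0. \<forall>s\<in>{0..t}. \<forall>j\<in>{1..N}. \<forall>k\<in>{1..N}. j \<noteq> k \<longrightarrow> \<delta> \<le> norm (x j s - x k s)"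
proof -
  let ?P = "{(j, k). j \<in> {1..N} \<and> k \<in> {1..N} \<and> j \<noteq> k}"
  have fin: "finite ?P"
    by (rule finite_subset[of _ "{1..N} \<times> {1..N}"]) auto
  have "\<exists>\<delta>>0. \<forall>s\<in>{0..t}. \<delta> \<le> norm (x j s - x k s)" if "(j, k) \<in> ?P" for j k
  proof (cases "0 \<le> t")
    case True
    have lt: "ereal s < T" if "s \<in> {0..t}" for s
      using that assms(2) ereal_le_less_trans by auto
    have "continuous_on {0..t} (x i)" if "i \<in> {1..N}" for i
      using assms that by (intro vortex_solution_continuous_on)
    then have "continuous_on {0..t} (\<lambda>s. norm (x j s - x k s))"
      using that by (auto intro!: continuous_intros)
    then obtain s\<^sub>0 where s\<^sub>0: "s\<^sub>0 \<in> {0..t}" "\<forall>s\<in>{0..t}. norm (x j s\<^sub>0 - x k s\<^sub>0) \<le> norm (x j s - x k s)"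
      using continuous_attains_inf[of "{0..t}" "\<lambda>s. norm (x j s - x k s)"] True by auto
    have "x j s\<^sub>0 \<noteq> x k s\<^sub>0"
      using that assms(1) lt[OF s\<^sub>0(1)] s\<^sub>0(1) unfolding vortex_solution_def by auto
    then show ?thesis
      using s\<^sub>0 by (intro exI[of _ "norm (x j s\<^sub>0 - x k s\<^sub>0)"]) auto
  qed (auto intro: exI[of _ 1])
  then have "\<forall>q\<in>?P. \<exists>\<delta>>0. \<forall>s\<in>{0..t}. \<delta> \<le> norm (x (fst q) s - x (snd q) s)"
    by auto
  from bchoice[OF this] obtain \<delta> where
    \<delta>: "\<forall>q\<in>?P. 0 < \<delta> q \<and> (\<forall>s\<in>{0..t}. \<delta> q \<le> norm (x (fst q) s - x (snd q) s))" ..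
  \<comment> \<open>The extra element 1 keeps the minimum meaningful when there are no pairs at
    all.\<close>
  let ?d = "Min (insert 1 (\<delta> ` ?P))"
  have "0 < ?d"
    using fin \<delta> by (subst Min_gr_iff) auto
  moreover have "?d \<le> norm (x j s - x k s)" if "(j, k) \<in> ?P" "s \<in> {0..t}" for j k s
  proof -
    have "?d \<le> \<delta> (j, k)"
      using fin that by (intro Min_le) auto
    also have "\<dots> \<le> norm (x j s - x k s)"
      using \<delta> that by force
    finally show ?thesis .
  qed
  ultimately show ?thesis
    by (intro exI[of _ ?d]) auto
qed

text \<open>Gronwall's argument for \<open>E t = \<Sum>j. \<bar>x\<^sub>j t - x'\<^sub>j t\<bar>\<^sup>2\<close>.\<close>

lemma vortex_solution_unique:
  assumes x: "vortex_solution N m y T x" and x': "vortex_solution N m y T' x'"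
    and t: "0 \<le> t" "ereal t < T" "ereal t < T'" and j: "j \<in> {1..N}"
  shows "x j t = x' j t"
proof -
  obtain \<delta>\<^sub>1 where \<delta>\<^sub>1: "\<delta>\<^sub>1 > 0"
    "\<And>s j k. s \<in> {0..t} \<Longrightarrow> j \<in> {1..N} \<Longrightarrow> k \<in> {1..N} \<Longrightarrow> j \<noteq> k \<Longrightarrow> \<delta>\<^sub>1 \<le> norm (x j s - x k s)"
    using vortex_solution_separated[OF x t(2)] by blast
  obtain \<delta>\<^sub>2 where \<delta>\<^sub>2: "\<delta>\<^sub>2 > 0"
    "\<And>s j k. s \<in> {0..t} \<Longrightarrow> j \<in> {1..N} \<Longrightarrow> k \<in> {1..N} \<Longrightarrow> j \<noteq> k \<Longrightarrow> \<delta>\<^sub>2 \<le> norm (x' j s - x' k s)"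
    using vortex_solution_separated[OF x' t(3)] by blast
  define \<delta> where "\<delta> = min \<delta>\<^sub>1 \<delta>\<^sub>2"
  define W where "W = (\<Sum>k\<in>{1..N}. \<bar>real_of_int (m k)\<bar>)"
  \<comment> \<open>The derivative of \<open>E\<close> has \<open>N\<close> summands, each at most
    twice the Lipschitz constant times \<open>E\<close>.\<close>
  define L where "L = 2 * N * (4 * W\<^sup>2 / \<delta>\<^sup>2)"
  define e where "e = (\<lambda>j s. x j s - x' j s)"
  define E where "E = (\<lambda>s. \<Sum>j\<in>{1..N}. e j s \<bullet> e j s)"
  have lt: "ereal s < T" "ereal s < T'" if "s \<in> {0..t}" for s
    using that t ereal_le_less_trans by auto
  have "E s \<ge> 0" for s
    unfolding E_def by (intro sum_nonneg) auto
  have E_deriv: "\<exists>D. (E has_real_derivative D) (at s) \<and> D \<le> L * E s" if "0 < s" "s < t" for s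
  proof -
    have s: "s \<in> {0..t}"
      using that by auto
    define v where "v = (\<lambda>j. vortex_velocity N m (\<lambda>k. x k s) j - vortex_velocity N m (\<lambda>k. x' k s) j)"
    have v: "(e j has_vector_derivative v j) (at s)" if "j \<in> {1..N}" for j
      unfolding e_def v_def using x x' lt[OF s] \<open>0 < s\<close> that
      by (intro has_vector_derivative_diff) (auto simp: vortex_solution_def)
    have "((\<lambda>s. e j s \<bullet> e j s) has_real_derivative 2 * (e j s \<bullet> v j)) (at s)"
      if "j \<in> {1..N}" for j
      using has_derivative_inner[OF v[OF that, unfolded has_vector_derivative_def] v[OF that, unfolded has_vector_derivative_def]]
      by (rule has_derivative_imp_has_field_derivative) (simp add: inner_commute)
    then have "(E has_real_derivative (\<Sum>j\<in>{1..N}. 2 * (e j s \<bullet> v j))) (at s)"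
      unfolding E_def by (intro DERIV_sum) auto
    moreover have "(\<Sum>j\<in>{1..N}. 2 * (e j s \<bullet> v j)) \<le> (\<Sum>j\<in>{1..N}. 2 * (4 * W\<^sup>2 / \<delta>\<^sup>2) * E s)"
    proof (rule sum_mono)
      fix j assume j: "j \<in> {1..N}"
      \<comment> \<open>The square root of \<open>E\<close> dominates every single error, so it can
        serve as the common bound in the Lipschitz estimate.\<close>
      have le: "norm (e k s) \<le> sqrt (E s)" if "k \<in> {1..N}" for k
        unfolding norm_eq_sqrt_inner real_sqrt_le_iff E_def
        using member_le_sum[of k "{1..N}" "\<lambda>k. e k s \<bullet> e k s"] that by simp
      have "norm (v j) \<le> 4 * W\<^sup>2 / \<delta>\<^sup>2 * sqrt (E s)"
        unfolding v_def W_def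
      proof (rule vortex_velocity_Lipschitz)
        show "0 < \<delta>"
          using \<delta>\<^sub>1 \<delta>\<^sub>2 by (simp add: \<delta>_def)
        show "\<delta> \<le> norm (x i s - x k s) \<and> \<delta> \<le> norm (x' i s - x' k s)"
          if "i \<in> {1..N}" "k \<in> {1..N}" "i \<noteq> k" for i k
          using \<delta>\<^sub>1(2)[OF s that] \<delta>\<^sub>2(2)[OF s that] by (simp add: \<delta>_def min_le_iff_disj)
        show "norm (x i s - x' i s) \<le> sqrt (E s)" if "i \<in> {1..N}" for i
          using le[OF that] by (simp add: e_def)
      qed (rule j)
      then have "norm (e j s) * norm (v j) \<le> sqrt (E s) * (4 * W\<^sup>2 / \<delta>\<^sup>2 * sqrt (E s))"
        using le[OF j] by (intro mult_mono) (auto simp: \<open>E s \<ge> 0\<close>)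
      also have "\<dots> = 4 * W\<^sup>2 / \<delta>\<^sup>2 * E s"
        using \<open>E s \<ge> 0\<close> by simp
      finally show "2 * (e j s \<bullet> v j) \<le> 2 * (4 * W\<^sup>2 / \<delta>\<^sup>2) * E s"
        using norm_cauchy_schwarz[of "e j s" "v j"] by linarith
    qed
    ultimately show ?thesis
      by (intro exI conjI) (auto simp: L_def mult_ac)
  qed
  \<comment> \<open>The version for open intervals fits here: a solution is assumed differentiable
    at positive times and merely continuous at 0.\<close>
  have "E t * exp (- L * t) \<le> E 0 * exp (- L * 0)"
  proof (rule DERIV_nonpos_imp_decreasing_open[OF t(1)])
    fix s assume "0 < s" "s < t"
    with E_deriv obtain D where D: "(E has_real_derivative D) (at s)" "D \<le> L * E s"
      by blast
    have "((\<lambda>s. E s * exp (- L * s)) has_real_derivative (D - L * E s) * exp (- L * s)) (at s)"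
      by (rule derivative_eq_intros D refl | simp add: algebra_simps)+
    moreover have "(D - L * E s) * exp (- L * s) \<le> 0"
      using D by (simp add: mult_nonpos_nonneg)
    ultimately show "\<exists>D. ((\<lambda>s. E s * exp (- L * s)) has_real_derivative D) (at s) \<and> D \<le> 0"
      by blast
  next
    have "continuous_on {0..t} (e j)" if "j \<in> {1..N}" for j
    proof -
      have "continuous_on {0..t} (x j)" "continuous_on {0..t} (x' j)"
        using x x' t that by (auto intro: vortex_solution_continuous_on)
      then show ?thesis
        unfolding e_def by (rule continuous_on_diff)
    qed
    then show "continuous_on {0..t} (\<lambda>s. E s * exp (- L * s))"
      unfolding E_def by (intro continuous_intros) auto
  qed
  moreover have "E 0 = 0"
    unfolding E_def e_def using x x' by (auto simp: vortex_solution_def)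
  ultimately have "E t \<le> 0"
    by (simp add: mult_le_0_iff)
  with \<open>E t \<ge> 0\<close> have "(\<Sum>j\<in>{1..N}. e j t \<bullet> e j t) = 0"
    by (simp add: E_def)
  then have "\<forall>j\<in>{1..N}. e j t \<bullet> e j t = 0"
    by (subst (asm) sum_nonneg_eq_0_iff) auto
  with j have "e j t \<bullet> e j t = 0"
    by blast
  then show ?thesis
    by (simp add: e_def)
qed

section \<open>Two-ring solutions\<close>

lemma inj_on_unit_dir_angle:
  assumes "n > 0"
  shows "inj_on (\<lambda>j. unit_dir (inner_angle n \<theta> j)) {1..n}"
    "inj_on (\<lambda>j. unit_dir (outer_angle n \<theta> j)) {1..n}"
proof -
  have inj: "inj_on (\<lambda>j. unit_dir (2 * (real j - 1) * pi / real n + \<phi>)) {1..n}" for \<phi>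
  proof (rule inj_onI)
    fix j k assume jk: "j \<in> {1..n}" "k \<in> {1..n}"
      "unit_dir (2 * (real j - 1) * pi / real n + \<phi>) = unit_dir (2 * (real k - 1) * pi / real n + \<phi>)"
    have "vec_of_complex z = 0 \<longleftrightarrow> z = 0" for z
      using norm_vec_of_complex[of z] by (metis norm_eq_zero)
    then have "cis (2 * (real j - 1) * pi / real n + \<phi>) = cis (2 * (real k - 1) * pi / real n + \<phi>)"
      using jk(3) linear_diff[OF linear_vec_of_complex] unfolding unit_dir_eq
      by (metis right_minus_eq)
    then have "unity_root n j = unity_root n k"
      by (simp add: unity_root_def cis_mult[symmetric])
    with bij_betw_unity_root[OF assms] jk show "j = k"
      by (auto simp: bij_betw_def dest: inj_onD)
  qed
  show "inj_on (\<lambda>j. unit_dir (inner_angle n \<theta> j)) {1..n}"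
    using inj[of \<theta>] by (simp add: inner_angle_def)
  show "inj_on (\<lambda>j. unit_dir (outer_angle n \<theta> j)) {1..n}"
    using inj[of "pi / real n + \<theta>"] by (simp add: outer_angle_def add.assoc)
qed

lemma two_ring_inner [simp]:
  "j \<in> {1..n} \<Longrightarrow> two_ring n \<theta> r\<^sub>1 r\<^sub>2 j = r\<^sub>1 *\<^sub>R unit_dir (inner_angle n \<theta> j)"
  by (simp add: two_ring_def)

lemma two_ring_outer [simp]:
  "j \<in> {1..n} \<Longrightarrow> two_ring n \<theta> r\<^sub>1 r\<^sub>2 (n + j) = r\<^sub>2 *\<^sub>R unit_dir (outer_angle n \<theta> j)"
  by (simp add: two_ring_def)

lemma two_ring_center [simp]: "two_ring n \<theta> r\<^sub>1 r\<^sub>2 (Suc (2 * n)) = 0"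
  by (simp add: two_ring_def)

lemma two_ring_cases:
  assumes "j \<in> {1..2 * n + 1}"
  obtains "j \<in> {1..n}" | i where "i \<in> {1..n}" "j = n + i" | "j = Suc (2 * n)"
proof (cases "j \<le> n")
  case False
  then show ?thesis
    using assms that(2)[of "j - n"] that(3) by (cases "j = Suc (2 * n)") auto
qed (use assms that(1) in auto)

text \<open>The centre and the two rings are told apart by the norm alone; within a ring the
  directions are distinct.\<close>

lemma two_ring_distinct:
  assumes "0 < r\<^sub>1" "r\<^sub>1 < r\<^sub>2" "j \<in> {1..2 * n + 1}" "k \<in> {1..2 * n + 1}" "j \<noteq> k"
  shows "two_ring n \<theta> r\<^sub>1 r\<^sub>2 j \<noteq> two_ring n \<theta> r\<^sub>1 r\<^sub>2 k"
proof
  assume eq: "two_ring n \<theta> r\<^sub>1 r\<^sub>2 j = two_ring n \<theta> r\<^sub>1 r\<^sub>2 k"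
  then have norm: "norm (two_ring n \<theta> r\<^sub>1 r\<^sub>2 j) = norm (two_ring n \<theta> r\<^sub>1 r\<^sub>2 k)"
    by simp
  show False
    using assms(3)
  proof (cases rule: two_ring_cases)
    case 1
    note j = this
    from assms(4) show ?thesis
    proof (cases rule: two_ring_cases)
      case 1
      have "n > 0" using 1 by auto
      have "unit_dir (inner_angle n \<theta> j) = unit_dir (inner_angle n \<theta> k)"
        using eq j 1 assms by simp
      then show ?thesis
        using inj_onD[OF inj_on_unit_dir_angle(1)[OF \<open>n > 0\<close>]] j 1 assms(5) by blast
    qed (use j norm assms in auto)
  next
    case (2 i)
    note j = this
    from assms(4) show ?thesis
    proof (cases rule: two_ring_cases)
      case (2 l)
      have "n > 0" using 2 by auto
      have "unit_dir (outer_angle n \<theta> i) = unit_dir (outer_angle n \<theta> l)"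
        using eq j 2 assms by simp
      then show ?thesis
        using inj_onD[OF inj_on_unit_dir_angle(2)[OF \<open>n > 0\<close>]] j 2 assms(5) by blast
    qed (use j norm assms in auto)
  next
    case 3
    from assms(4) show ?thesis
      by (cases rule: two_ring_cases) (use 3 norm assms in auto)
  qed
qed

lemma two_ring_vortex_solution:
  fixes \<rho>\<^sub>1 \<rho>\<^sub>2 :: "real \<Rightarrow> real"
  assumes n: "n \<ge> 2" and m\<^sub>0: "m\<^sub>0 = 1 \<or> m\<^sub>0 = -1"
    and m: "m (2 * n + 1) = - m\<^sub>0" "\<forall>j\<in>{1..2 * n}. m j = m\<^sub>0"
    and y: "\<And>j. j \<in> {1..2 * n + 1} \<Longrightarrow> y j = two_ring n \<theta> (sqrt (\<rho>\<^sub>1 0)) (sqrt (\<rho>\<^sub>2 0)) j"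
    and "0 < T"
    and pos: "\<And>t. 0 \<le> t \<Longrightarrow> ereal t < T \<Longrightarrow> 0 < \<rho>\<^sub>1 t \<and> \<rho>\<^sub>1 t < \<rho>\<^sub>2 t"
    and \<rho>\<^sub>1: "\<And>t. 0 \<le> t \<Longrightarrow> ereal t < T \<Longrightarrow> (\<rho>\<^sub>1 has_real_derivative
      2 * (real n - 3) + 4 * real n * ring_share n (sqrt (\<rho>\<^sub>1 t)) (sqrt (\<rho>\<^sub>2 t))) (at t)"
    and \<rho>\<^sub>2: "\<And>t. 0 \<le> t \<Longrightarrow> ereal t < T \<Longrightarrow> (\<rho>\<^sub>2 has_real_derivative
      2 * (real n - 3) + 4 * real n * ring_share n (sqrt (\<rho>\<^sub>2 t)) (sqrt (\<rho>\<^sub>1 t))) (at t)"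
  shows "vortex_solution (2 * n + 1) m y T (\<lambda>j t. two_ring n \<theta> (sqrt (\<rho>\<^sub>1 t)) (sqrt (\<rho>\<^sub>2 t)) j)"
proof -
  define x where "x = (\<lambda>j t. two_ring n \<theta> (sqrt (\<rho>\<^sub>1 t)) (sqrt (\<rho>\<^sub>2 t)) j)"
  have deriv: "(x j has_vector_derivative vortex_velocity (2 * n + 1) m (\<lambda>k. x k t) j) (at t)"
    if t: "0 \<le> t" "ereal t < T" and j: "j \<in> {1..2 * n + 1}" for j t
  proof -
    let ?r\<^sub>1 = "sqrt (\<rho>\<^sub>1 t)" and ?r\<^sub>2 = "sqrt (\<rho>\<^sub>2 t)"
    have r: "0 < ?r\<^sub>1" "0 < ?r\<^sub>2"
      using pos[OF t] by auto
    note vel = n r m\<^sub>0 m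
    \<comment> \<open>Writing the derivative of the squared radius as \<open>2 * D\<close> absorbs
      the factor 1/2 of the square root, so that \<open>D\<close> is the numerator in the radial
      velocity formulas.\<close>
    have scaled: "((\<lambda>t. sqrt (\<rho> t) *\<^sub>R v) has_vector_derivative (D / sqrt (\<rho> t)) *\<^sub>R v) (at t)"
      if "(\<rho> has_real_derivative 2 * D) (at t)" "0 < \<rho> t" for \<rho> D and v :: "real ^ 2"
    proof -
      have "((\<lambda>t. sqrt (\<rho> t)) has_real_derivative D / sqrt (\<rho> t)) (at t)"
        using that by (auto intro!: derivative_eq_intros simp: field_simps)
      then show ?thesis
        using has_vector_derivative_scaleR[of "\<lambda>t. sqrt (\<rho> t)" _ t UNIV "\<lambda>_. v" 0] by simp
    qed
    have x_t: "(\<lambda>k. x k t) = two_ring n \<theta> ?r\<^sub>1 ?r\<^sub>2"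
      by (simp add: x_def)
    show ?thesis
      using j
    proof (cases rule: two_ring_cases)
      case 1
      have x_j: "x j = (\<lambda>t. sqrt (\<rho>\<^sub>1 t) *\<^sub>R unit_dir (inner_angle n \<theta> j))"
        using 1 by (simp add: x_def)
      show ?thesis
        unfolding x_t velocity_inner[OF vel 1] x_j
        by (rule scaled) (use \<rho>\<^sub>1[OF t] pos[OF t] in \<open>auto simp: algebra_simps\<close>)
    next
      case (2 i)
      have x_j: "x j = (\<lambda>t. sqrt (\<rho>\<^sub>2 t) *\<^sub>R unit_dir (outer_angle n \<theta> i))"
        using 2 by (simp add: x_def)
      show ?thesis
        unfolding x_t velocity_outer[OF vel 2(1), folded 2(2)] x_j
        by (rule scaled) (use \<rho>\<^sub>2[OF t] pos[OF t] in \<open>auto simp: algebra_simps\<close>)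
    next
      case 3
      have x_j: "x j = (\<lambda>t. 0)"
        using 3 by (simp add: x_def)
      have "vortex_velocity (2 * n + 1) m (two_ring n \<theta> ?r\<^sub>1 ?r\<^sub>2) j = 0"
        using velocity_center[OF vel] 3 by simp
      then show ?thesis
        unfolding x_t x_j by simp
    qed
  qed
  have "continuous_on {t. 0 \<le> t \<and> ereal t < T} (x j)" if "j \<in> {1..2 * n + 1}" for j
    using deriv that
    by (intro continuous_at_imp_continuous_on ballI has_vector_derivative_continuous) blast
  moreover have "x j t \<noteq> x l t"
    if "0 \<le> t" "ereal t < T" "j \<in> {1..2 * n + 1}" "l \<in> {1..2 * n + 1}" "j \<noteq> l" for t j l
    unfolding x_def using that pos by (intro two_ring_distinct) auto
  moreover have "x j 0 = y j" if "j \<in> {1..2 * n + 1}" for j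
    using y that by (simp add: x_def)
  ultimately show ?thesis
    unfolding vortex_solution_def x_def[symmetric] using deriv \<open>0 < T\<close> by auto
qed

lemma the_vortex_solution_global:
  assumes "vortex_solution N m y \<infinity> x"
  shows "the_vortex_solution N m y \<infinity> x"
  unfolding the_vortex_solution_def
proof (intro conjI allI impI ballI)
  fix T' x' j t assume "vortex_solution N m y T' x'" "j \<in> {1..N}" "0 \<le> t \<and> ereal t < T'"
  then show "x' j t = x j t"
    using vortex_solution_unique[OF _ assms] by auto
qed (use assms in auto)

section \<open>Scalar autonomous flows\<close>

text \<open>Separation of variables: \<open>s\<close> is the inverse of the time integral
  \<open>G\<close> of \<open>1 / \<kappa>\<close>. The bound \<open>L\<close> makes \<open>G\<close>
  grow with slope at least \<open>1 / L\<close>, so \<open>G\<close> is onto and \<open>s\<close>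
  exists for all time. Since \<open>G\<close> is finite everywhere, every level is reached in finite
  time, so \<open>s\<close> tends to infinity.\<close>

lemma positive_autonomous_flow:
  fixes \<kappa> :: "real \<Rightarrow> real"
  assumes cont: "continuous_on UNIV \<kappa>" and pos: "\<And>s. 0 < \<kappa> s" and le: "\<And>s. \<kappa> s \<le> L"
  obtains s where "s 0 = 0" "\<And>t. (s has_real_derivative \<kappa> (s t)) (at t)"
    "\<And>t. 0 \<le> t \<Longrightarrow> 0 \<le> s t" "filterlim s at_top at_top"
proof -
  have "L > 0"
    using pos[of 0] le[of 0] by linarith
  have "\<exists>F. \<forall>x. - \<infinity> < ereal x \<longrightarrow> ereal x < \<infinity> \<longrightarrow> (F has_vector_derivative 1 / \<kappa> x) (at x)"
  proof (rule einterval_antiderivative)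
    fix x :: real
    have "isCont \<kappa> x"
      using cont by (simp add: continuous_on_eq_continuous_at)
    then show "isCont (\<lambda>x. 1 / \<kappa> x) x"
      using pos[of x] by (intro continuous_intros) auto
  qed auto
  then obtain F where F: "\<And>x. (F has_real_derivative 1 / \<kappa> x) (at x)"
    by (auto simp: has_real_derivative_iff_has_vector_derivative)
  define G where "G x = F x - F 0" for x
  have G: "(G has_real_derivative 1 / \<kappa> x) (at x)" for x
    unfolding G_def by (rule derivative_eq_intros F refl | simp)+
  have growth: "(y - x) / L \<le> G y - G x" if "x \<le> y" for x y
  proof (cases "x = y")
    case False
    then have "x < y"
      using that by simp
    from MVT2[OF this, of G "\<lambda>x. 1 / \<kappa> x"] G obtain z where "G y - G x = (y - x) * (1 / \<kappa> z)"
      by blast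
    moreover have "1 / L \<le> 1 / \<kappa> z"
      using pos[of z] le[of z] by (simp add: frac_le)
    ultimately show ?thesis
      using \<open>x < y\<close> mult_left_mono[of "1 / L" "1 / \<kappa> z" "y - x"] by simp
  qed simp
  have "strict_mono G"
  proof (rule strict_monoI)
    fix x y :: real assume "x < y"
    then have "0 < (y - x) / L"
      using \<open>L > 0\<close> by simp
    then show "G x < G y"
      using growth[of x y] \<open>x < y\<close> by linarith
  qed
  have "G 0 = 0"
    by (simp add: G_def)
  have "\<exists>x. G x = t" for t
  proof -
    have "\<exists>x. - (L * \<bar>t\<bar>) \<le> x \<and> x \<le> L * \<bar>t\<bar> \<and> G x = t"
    proof (rule IVT')
      show "G (- (L * \<bar>t\<bar>)) \<le> t"
        using growth[of "- (L * \<bar>t\<bar>)" 0] \<open>G 0 = 0\<close> \<open>L > 0\<close> by simp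
      show "t \<le> G (L * \<bar>t\<bar>)"
        using growth[of 0 "L * \<bar>t\<bar>"] \<open>G 0 = 0\<close> \<open>L > 0\<close> by simp
      show "continuous_on {- (L * \<bar>t\<bar>)..L * \<bar>t\<bar>} G"
        by (meson G DERIV_isCont continuous_at_imp_continuous_on)
    qed (use \<open>L > 0\<close> in auto)
    then show ?thesis by blast
  qed
  then obtain s where s: "\<And>t. G (s t) = t"
    by metis
  have sG: "s (G x) = x" for x
    using s[of "G x"] \<open>strict_mono G\<close> by (simp add: strict_mono_eq)
  have mono: "s t \<le> s t'" if "t \<le> t'" for t t'
    using that s \<open>strict_mono G\<close> by (metis strict_mono_less_eq)
  have "isCont s t" for t
    using isCont_inverse_function[of 1 "s t" s G] sG s[of t] DERIV_isCont[OF G] by simp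
  then have "(s has_real_derivative inverse (1 / \<kappa> (s t))) (at t)" for t
    using DERIV_inverse_function[of G "1 / \<kappa> (s t)" s t "t - 1" "t + 1"] G s pos[of "s t"] by simp
  then have "(s has_real_derivative \<kappa> (s t)) (at t)" for t
    by simp
  moreover have "s 0 = 0"
    using sG[of 0] \<open>G 0 = 0\<close> by simp
  \<comment> \<open>The level \<open>x\<close> is passed from time \<open>G x\<close> on, by
    monotonicity and \<open>s (G x) = x\<close>.\<close>
  moreover have "filterlim s at_top at_top"
    unfolding filterlim_at_top eventually_at_top_linorder by (metis mono sG)
  ultimately show ?thesis
    using that mono by metis
qed

text \<open>
  Along \<open>u = z + exp (- s) * (u\<^sub>0 - z)\<close> the equation \<open>u' = g u\<close> becomes \<open>s' = \<kappa> s\<close>, where \<open>\<kappa>\<close> is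
  the ratio assumed to be positive and bounded.
\<close>

lemma autonomous_flow_to_equilibrium:
  fixes g :: "real \<Rightarrow> real"
  assumes cont: "continuous_on ((\<lambda>l. z + l * (u\<^sub>0 - z)) ` {0<..1}) g"
    and pos: "\<And>l v. 0 < l \<Longrightarrow> l \<le> 1 \<Longrightarrow> v = z + l * (u\<^sub>0 - z) \<Longrightarrow> 0 < g v / (z - v)"
    and le: "\<And>l v. 0 < l \<Longrightarrow> l \<le> 1 \<Longrightarrow> v = z + l * (u\<^sub>0 - z) \<Longrightarrow> g v / (z - v) \<le> L"
  shows "\<exists>u. u 0 = u\<^sub>0 \<and>
    (\<forall>t\<ge>0. (u has_real_derivative g (u t)) (at t) \<and> u t \<in> (\<lambda>l. z + l * (u\<^sub>0 - z)) ` {0<..1}) \<and>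
    (u \<longlongrightarrow> z) at_top"
proof -
  have "u\<^sub>0 \<noteq> z"
    using pos[of 1 u\<^sub>0] by auto
  \<comment> \<open>The truncation \<open>max s 0\<close> extends the segment constantly to negative
    parameters, so that \<open>\<kappa>\<close> is continuous, positive and bounded on the whole
    line; the trajectory itself only sees nonnegative \<open>s\<close>.\<close>
  define V where "V s = z + exp (- max s 0) * (u\<^sub>0 - z)" for s :: real
  define \<kappa> where "\<kappa> s = g (V s) / (z - V s)" for s
  have V: "V s \<in> (\<lambda>l. z + l * (u\<^sub>0 - z)) ` {0<..1}" for s
    unfolding V_def by (rule imageI) auto
  have "V s \<noteq> z" for s
    using \<open>u\<^sub>0 \<noteq> z\<close> by (simp add: V_def)
  moreover have "continuous_on UNIV V"
    unfolding V_def by (intro continuous_intros)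
  moreover from this have "continuous_on UNIV (\<lambda>s. g (V s))"
    by (rule continuous_on_compose2[OF cont]) (use V in blast)
  ultimately have "continuous_on UNIV \<kappa>"
    unfolding \<kappa>_def by (intro continuous_intros) auto
  moreover have "0 < \<kappa> s" "\<kappa> s \<le> L" for s
    unfolding \<kappa>_def
    using pos[of "exp (- max s 0)" "V s"] le[of "exp (- max s 0)" "V s"] by (auto simp: V_def)
  ultimately obtain s where s: "s 0 = 0" "\<And>t. (s has_real_derivative \<kappa> (s t)) (at t)"
    "\<And>t. 0 \<le> t \<Longrightarrow> 0 \<le> s t" "filterlim s at_top at_top"
    using positive_autonomous_flow by metis
  define u where "u t = z + exp (- s t) * (u\<^sub>0 - z)" for t
  have uV: "u t = V (s t)" if "0 \<le> t" for t
    using s(3)[OF that] by (simp add: u_def V_def max_absorb1)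
  have "(u has_real_derivative g (u t)) (at t)" if "0 \<le> t" for t
  proof -
    have "(u has_real_derivative - (\<kappa> (s t) * (u t - z))) (at t)"
      unfolding u_def by (rule derivative_eq_intros s refl | simp)+
    moreover have "- (\<kappa> (s t) * (u t - z)) = g (u t)"
      using \<open>V (s t) \<noteq> z\<close> by (simp add: \<kappa>_def uV[OF that] field_simps)
    ultimately show ?thesis by simp
  qed
  moreover have "(u \<longlongrightarrow> z) at_top"
  proof -
    have "((\<lambda>t. exp (- s t)) \<longlongrightarrow> 0) at_top"
      by (rule filterlim_compose[OF exp_at_bot])
        (use s(4) in \<open>simp add: filterlim_uminus_at_bot\<close>)
    then have "(u \<longlongrightarrow> z + 0 * (u\<^sub>0 - z)) at_top"
      unfolding u_def by (intro tendsto_intros)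
    then show ?thesis by simp
  qed
  ultimately show ?thesis
    using uV V s(1) by (intro exI[of _ u]) (simp add: u_def)
qed

text \<open>\<open>ring_share\<close> is homogeneous of degree 0, so it depends only on the fraction
  \<open>u\<close> of the inner squared radius; here \<open>p\<close> stands for
  \<open>n / 2\<close>.\<close>

definition pshare :: "real \<Rightarrow> real \<Rightarrow> real" where
  "pshare p u = u powr p / (u powr p + (1 - u) powr p)"

section \<open>Bounds, derivative and convexity of the interaction share\<close>

lemma pshare_pos: "0 < u \<Longrightarrow> u < 1 \<Longrightarrow> 0 < pshare p u"
  by (simp add: pshare_def add_pos_pos)

lemma one_minus_pshare:
  assumes "0 < u" "u < 1"
  shows "1 - pshare p u = (1 - u) powr p / (u powr p + (1 - u) powr p)"
proof -
  have "u powr p + (1 - u) powr p > 0"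
    using assms by (simp add: add_pos_pos)
  then show ?thesis
    by (simp add: pshare_def field_simps)
qed

lemma pshare_less_1: "0 < u \<Longrightarrow> u < 1 \<Longrightarrow> pshare p u < 1"
  using one_minus_pshare[of u p] by (simp add: pshare_def add_pos_pos)

lemma pshare_le_ratio:
  assumes "0 < u" "u < 1"
  shows "pshare p u \<le> (u / (1 - u)) powr p"
proof -
  have "pshare p u \<le> u powr p / (1 - u) powr p"
    unfolding pshare_def using assms by (intro divide_left_mono) (auto simp: add_pos_pos)
  then show ?thesis
    using assms by (simp add: powr_divide)
qed

text \<open>For \<open>u < 1 - u\<close> a power with exponent above 1 makes the odds even
  smaller.\<close>

lemma pshare_less:
  assumes "0 < u" "u < 1 / 2" "1 < p"
  shows "pshare p u < u"
proof -
  have "u powr (p - 1) < (1 - u) powr (p - 1)"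
    using assms by (intro powr_less_mono2) auto
  then have "u powr (p - 1) * (u * (1 - u)) < (1 - u) powr (p - 1) * (u * (1 - u))"
    using assms by simp
  then have "u powr p * (1 - u) < u * (1 - u) powr p"
    using assms by (simp add: powr_diff mult.commute)
  then show ?thesis
    using assms by (simp add: pshare_def add_pos_pos divide_less_eq algebra_simps)
qed

lemma pshare_half: "pshare p (1 / 2) = 1 / 2"
  by (simp add: pshare_def)

text \<open>\<open>pshare p u\<close> is the logistic function of
  \<open>p * ln (u / (1 - u))\<close>. The logistic function \<open>h\<close> has derivative
  \<open>h * (1 - h)\<close>, and the inner function has derivative
  \<open>p / (u * (1 - u))\<close>.\<close>

lemma pshare_deriv:
  assumes "0 < u" "u < 1"
  shows "(pshare p has_real_derivative p * (pshare p u * (1 - pshare p u)) / (u * (1 - u))) (at u)"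
proof -
  define a b where "a = u powr p" and "b = (1 - u) powr p"
  have pos: "a > 0" "b > 0"
    using assms by (auto simp: a_def b_def)
  have "(pshare p has_real_derivative
      ((p * u powr (p - 1)) * (a + b) - a * (p * u powr (p - 1) - p * (1 - u) powr (p - 1))) /
        ((a + b) * (a + b))) (at u)"
    unfolding pshare_def[abs_def] a_def b_def using assms
    by (auto intro!: derivative_eq_intros simp: add_pos_pos less_imp_neq[THEN not_sym])
  moreover have "u powr (p - 1) = a / u" "(1 - u) powr (p - 1) = b / (1 - u)"
    using assms by (simp_all add: powr_diff a_def b_def)
  moreover have "p * (pshare p u * (1 - pshare p u)) / (u * (1 - u)) =
      ((p * (a / u)) * (a + b) - a * (p * (a / u) - p * (b / (1 - u)))) / ((a + b) * (a + b))"
  proof -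
    have "pshare p u = a / (a + b)" "1 - pshare p u = b / (a + b)"
      using one_minus_pshare[OF assms, of p] by (simp_all only: pshare_def a_def b_def)
    moreover have "a + b \<noteq> 0" "u \<noteq> 0" "1 - u \<noteq> 0"
      using pos assms by auto
    moreover have "(p * (a / u)) * (a + b) - a * (p * (a / u) - p * (b / (1 - u))) =
        p * (a * b) / (u * (1 - u))"
      using \<open>u \<noteq> 0\<close> \<open>1 - u \<noteq> 0\<close> by (simp add: divide_simps) (simp add: algebra_simps)
    ultimately show ?thesis
      by (simp add: mult_ac)
  qed
  ultimately show ?thesis
    by simp
qed

text \<open>
  With \<open>H = pshare p\<close> the sign of \<open>H''\<close> is that of \<open>p * (1 - 2 * H u) - (1 - 2 * u)\<close>, which is
  nonnegative because \<open>H u \<le> u\<close>.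
\<close>

lemma convex_on_pshare:
  assumes "1 < p"
  shows "convex_on {0<..1 / 2} (pshare p)"
proof (rule f''_ge0_imp_convex)
  let ?H = "pshare p"
  let ?D = "\<lambda>u. p * (?H u * (1 - ?H u)) / (u * (1 - u))"
  let ?DD = "\<lambda>u. p * (?H u * (1 - ?H u)) * (p * (1 - 2 * ?H u) - (1 - 2 * u)) / (u * (1 - u))\<^sup>2"
  fix u :: real assume u: "u \<in> {0<..1 / 2}"
  then have u01: "0 < u" "u < 1"
    by auto
  show "(?H has_real_derivative ?D u) (at u)"
    by (rule pshare_deriv[OF u01])
  have "(?D has_real_derivative
      ((p * (?D u * (1 - ?H u) - ?H u * ?D u)) * (u * (1 - u)) -
        p * (?H u * (1 - ?H u)) * (1 - 2 * u)) / ((u * (1 - u)) * (u * (1 - u)))) (at u)"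
  proof (rule DERIV_divide)
    show "((\<lambda>u. p * (?H u * (1 - ?H u))) has_real_derivative p * (?D u * (1 - ?H u) - ?H u * ?D u)) (at u)"
      by (rule derivative_eq_intros pshare_deriv[OF u01] refl | simp add: algebra_simps)+
    show "((\<lambda>u. u * (1 - u)) has_real_derivative 1 - 2 * u) (at u)"
      by (rule derivative_eq_intros refl | simp add: algebra_simps)+
  qed (use u01 in auto)
  moreover have "((p * (?D u * (1 - ?H u) - ?H u * ?D u)) * (u * (1 - u)) -
        p * (?H u * (1 - ?H u)) * (1 - 2 * u)) / ((u * (1 - u)) * (u * (1 - u))) = ?DD u"
  proof -
    \<comment> \<open>Here \<open>d\<close> stands for \<open>p * (H u * (1 - H u))\<close>,
      \<open>w\<close> for \<open>u * (1 - u)\<close>, \<open>h\<close> for \<open>H u\<close> and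
      \<open>v\<close> for \<open>1 - 2 * u\<close>; the first derivative is then
      \<open>d / w\<close>.\<close>
    have "((p * (d / w * (1 - h) - h * (d / w))) * w - d * v) / (w * w) = d * (p * (1 - 2 * h) - v) / w\<^sup>2"
      if "w \<noteq> 0" for d w h v :: real
    proof -
      have "p * (d / w * (1 - h) - h * (d / w)) * w = d * (p * (1 - 2 * h))"
        using that by (simp add: field_simps)
      then show ?thesis
        by (simp add: power2_eq_square right_diff_distrib)
    qed
    then show ?thesis
      using u01 by simp
  qed
  ultimately show "(?D has_real_derivative ?DD u) (at u)"
    by simp
  have "?H u \<le> u"
    using pshare_less[of u p] pshare_half[of p] u assms by (cases "u = 1 / 2") (simp_all only: order_refl, auto)
  then have "1 * (1 - 2 * u) \<le> p * (1 - 2 * ?H u)"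
    using u assms by (intro mult_mono) auto
  then show "0 \<le> ?DD u"
    using pshare_pos[OF u01, of p] pshare_less_1[OF u01, of p] u01 assms
    by (intro divide_nonneg_nonneg mult_nonneg_nonneg) auto
qed simp

section \<open>The ratio of the squared radii\<close>

text \<open>
  The right-hand side of the equation for the fraction \<open>u = \<rho>\<^sub>1 / (\<rho>\<^sub>1 + \<rho>\<^sub>2)\<close> in logarithmic time.
\<close>

definition ratio_field :: "nat \<Rightarrow> real \<Rightarrow> real" where
  "ratio_field n u = 2 * (real n - 3) + 4 * n * pshare (n / 2) u - (8 * real n - 12) * u"

lemma continuous_on_ratio_field: "continuous_on {0<..<1} (ratio_field n)"
proof -
  have "continuous_on {0<..<1} (pshare p)" for p
  proof (rule continuous_at_imp_continuous_on, rule ballI)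
    fix u :: real assume "u \<in> {0<..<1}"
    then show "isCont (pshare p) u"
      by (intro DERIV_isCont[OF pshare_deriv]) auto
  qed
  then show ?thesis
    unfolding ratio_field_def[abs_def] by (intro continuous_intros)
qed

lemma ratio_field_half: "n > 0 \<Longrightarrow> ratio_field n (1 / 2) = 0"
  by (simp add: ratio_field_def pshare_half)

text \<open>The field is a positive multiple of the convex share plus an affine function. The
  three-point form without quotients lets signs be read off directly and also covers degenerate
  intervals.\<close>

lemma ratio_field_convex:
  assumes "n \<ge> 3" "0 < a" "a \<le> b" "b \<le> c" "c \<le> 1 / 2"
  shows "(c - a) * ratio_field n b \<le> (c - b) * ratio_field n a + (b - a) * ratio_field n c"
proof (cases "a = c")
  case False
  then have "a < c"
    using assms by simp
  have "convex_on {a..c} (pshare (n / 2))"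
    by (rule convex_on_subset[OF convex_on_pshare]) (use assms in auto)
  from convex_onD_Icc'[OF this, of b]
  have "pshare (n / 2) b \<le> (pshare (n / 2) c - pshare (n / 2) a) / (c - a) * (b - a) + pshare (n / 2) a"
    using assms by simp
  then have "(c - a) * pshare (n / 2) b \<le>
      (c - a) * ((pshare (n / 2) c - pshare (n / 2) a) / (c - a) * (b - a) + pshare (n / 2) a)"
    using \<open>a < c\<close> by (intro mult_left_mono) auto
  also have "\<dots> = (c - b) * pshare (n / 2) a + (b - a) * pshare (n / 2) c"
    using \<open>a < c\<close> by (simp add: divide_simps) (simp add: algebra_simps)
  finally have "4 * real n * ((c - a) * pshare (n / 2) b) \<le>
      4 * real n * ((c - b) * pshare (n / 2) a + (b - a) * pshare (n / 2) c)"
    by (intro mult_left_mono) auto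
  then show ?thesis
    unfolding ratio_field_def by (simp add: algebra_simps)
qed (use assms in simp)

text \<open>With \<open>q\<close> the \<open>n / 2\<close>-th power of the odds 3 : 2, the field at
  2/5 equals \<open>4 * n / (1 + q) - 6 / 5 * (n + 1)\<close>, and \<open>q\<close> grows with
  \<open>n\<close>.\<close>

lemma ratio_field_two_fifths:
  assumes "n \<ge> 4"
  shows "ratio_field n (2 / 5) < 0"
proof -
  define q :: real where "q = (3 / 2) powr (n / 2)"
  have "q > 0"
    by (simp add: q_def)
  have "(3 / 5) powr (n / 2) = q * (2 / 5) powr (n / 2)"
    unfolding q_def by (simp add: powr_mult[symmetric])
  then have "pshare (n / 2) (2 / 5) = (2 / 5) powr (n / 2) / ((2 / 5) powr (n / 2) * (1 + q))"
    by (simp add: pshare_def algebra_simps)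
  then have "pshare (n / 2) (2 / 5) = 1 / (1 + q)"
    using \<open>q > 0\<close> by simp
  moreover have "real n * (10 / 3) < (real n + 1) * (1 + q)"
  \<comment> \<open>From \<open>n = 5\<close> on, \<open>q \<ge> 7 / 3\<close> and hence
    \<open>1 + q \<ge> 10 / 3\<close>, which is enough. For \<open>n = 4\<close> the value
    \<open>q = 9 / 4\<close> just misses this, so it is inserted exactly.\<close>
  proof (cases "n = 4")
    case True
    then have "q = (3 / 2) powr real 2"
      by (simp add: q_def)
    then have "q = 9 / 4"
      using powr_realpow[of "3 / 2 :: real" 2] by (simp add: power2_eq_square)
    with True show ?thesis by simp
  next
    case False
    have "q\<^sup>2 = (3 / 2) powr real n"
      by (simp add: q_def power2_eq_square powr_add[symmetric])
    also have "\<dots> \<ge> (3 / 2) powr real 5"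
      using assms False by (intro powr_mono) auto
    also have "(3 / 2 :: real) powr real 5 = (3 / 2) ^ 5"
      by (rule powr_realpow) simp
    finally have "(7 / 3)\<^sup>2 \<le> q\<^sup>2"
      by (simp add: power_numeral_reduce)
    then have "7 / 3 \<le> q"
      by (rule power2_le_imp_le) (use \<open>q > 0\<close> in simp)
    then have "(real n + 1) * (10 / 3) \<le> (real n + 1) * (1 + q)"
      by (intro mult_left_mono) auto
    then show ?thesis by simp
  qed
  then have "4 * real n * (1 / (1 + q)) < 6 / 5 * (real n + 1)"
    using \<open>q > 0\<close> by (simp add: field_simps)
  moreover define w where "w = 4 * real n * pshare (n / 2) (2 / 5)"
  ultimately have "w < 6 / 5 * (real n + 1)"
    by simp
  then have "2 * (real n - 3) + w - (8 * real n - 12) * (2 / 5) < 0"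
    by simp
  then show ?thesis
    by (simp only: ratio_field_def w_def)
qed

text \<open>Existence of a trajectory that stays inside the interval is part of the notion, because
  the squared radii are built from that trajectory. The limit may be the end point 0, as it is for
  \<open>n = 3\<close>.\<close>

definition attracting_ratio :: "nat \<Rightarrow> real \<Rightarrow> bool" where
  "attracting_ratio n z \<longleftrightarrow>
     (\<forall>u\<^sub>0. 0 < u\<^sub>0 \<and> u\<^sub>0 < 1 / 2 \<longrightarrow>
       (\<exists>u. u 0 = u\<^sub>0 \<and>
         (\<forall>t\<ge>0. (u has_real_derivative ratio_field n (u t)) (at t) \<and> 0 < u t \<and> u t < 1 / 2) \<and>
         (u \<longlongrightarrow> z) at_top))"

text \<open>Positivity of the quotient says that the field points towards \<open>z\<close> along the
  segment from \<open>u\<^sub>0\<close>; its upper bound prevents the trajectory from arriving at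
  \<open>z\<close> in finite time.\<close>

lemma attracting_ratioI:
  assumes z: "0 \<le> z" "z < 1 / 2"
    and stationary: "0 < z \<Longrightarrow> ratio_field n z = 0"
    and field: "\<And>u\<^sub>0. 0 < u\<^sub>0 \<Longrightarrow> u\<^sub>0 < 1 / 2 \<Longrightarrow> u\<^sub>0 \<noteq> z \<Longrightarrow>
      \<exists>L. \<forall>l v. 0 < l \<and> l \<le> 1 \<and> v = z + l * (u\<^sub>0 - z) \<longrightarrow>
        0 < ratio_field n v / (z - v) \<and> ratio_field n v / (z - v) \<le> L"
  shows "attracting_ratio n z"
  unfolding attracting_ratio_def
proof (intro allI impI)
  fix u\<^sub>0 :: real assume u\<^sub>0: "0 < u\<^sub>0 \<and> u\<^sub>0 < 1 / 2"
  show "\<exists>u. u 0 = u\<^sub>0 \<and>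
      (\<forall>t\<ge>0. (u has_real_derivative ratio_field n (u t)) (at t) \<and> 0 < u t \<and> u t < 1 / 2) \<and>
      (u \<longlongrightarrow> z) at_top"
  proof (cases "u\<^sub>0 = z")
    case True
    \<comment> \<open>Starting at \<open>z\<close> itself forces \<open>0 < z\<close>, so
      stationarity applies and the constant trajectory works.\<close>
    then show ?thesis
      using u\<^sub>0 stationary by (intro exI[of _ "\<lambda>_. z"]) auto
  next
    case False
    have range: "0 < z + l * (u\<^sub>0 - z) \<and> z + l * (u\<^sub>0 - z) < 1 / 2" if "l \<in> {0<..1}" for l
    proof -
      have "0 \<le> (1 - l) * z" "0 < l * u\<^sub>0" "l * u\<^sub>0 < l * (1 / 2)"
        using that z u\<^sub>0 by auto
      moreover have "(1 - l) * z \<le> (1 - l) * (1 / 2)"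
        using that z by (intro mult_left_mono) auto
      ultimately show ?thesis
        by (simp add: algebra_simps)
    qed
    from field[of u\<^sub>0] False u\<^sub>0 obtain L where L:
      "\<And>l v. 0 < l \<Longrightarrow> l \<le> 1 \<Longrightarrow> v = z + l * (u\<^sub>0 - z) \<Longrightarrow> 0 < ratio_field n v / (z - v)"
      "\<And>l v. 0 < l \<Longrightarrow> l \<le> 1 \<Longrightarrow> v = z + l * (u\<^sub>0 - z) \<Longrightarrow> ratio_field n v / (z - v) \<le> L"
      by blast
    have "continuous_on ((\<lambda>l. z + l * (u\<^sub>0 - z)) ` {0<..1}) (ratio_field n)"
      by (rule continuous_on_subset[OF continuous_on_ratio_field]) (use range in force)
    then have "\<exists>u. u 0 = u\<^sub>0 \<and>
        (\<forall>t\<ge>0. (u has_real_derivative ratio_field n (u t)) (at t) \<and>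
          u t \<in> (\<lambda>l. z + l * (u\<^sub>0 - z)) ` {0<..1}) \<and>
        (u \<longlongrightarrow> z) at_top"
      by (rule autonomous_flow_to_equilibrium[where L = L]) (blast intro: L)+
    then obtain u where u: "u 0 = u\<^sub>0"
      "\<forall>t\<ge>0. (u has_real_derivative ratio_field n (u t)) (at t) \<and>
        u t \<in> (\<lambda>l. z + l * (u\<^sub>0 - z)) ` {0<..1}"
      "(u \<longlongrightarrow> z) at_top"
      by blast
    moreover have "0 < u t \<and> u t < 1 / 2" if "t \<ge> 0" for t
      using u(2) that range by auto
    ultimately show ?thesis
      by (intro exI[of _ u]) simp
  qed
qed

text \<open>For \<open>n = 3\<close> the constant term drops out and the field is 12 times
  \<open>pshare (3 / 2) v - v\<close>. Both bounds on the quotient come from the share lying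
  strictly between 0 and \<open>v\<close>.\<close>

lemma attracting_ratio_3: "attracting_ratio 3 0"
proof (rule attracting_ratioI)
  fix u\<^sub>0 :: real assume u\<^sub>0: "0 < u\<^sub>0" "u\<^sub>0 < 1 / 2"
  have "0 < ratio_field 3 v / (0 - v) \<and> ratio_field 3 v / (0 - v) \<le> 12" if "0 < v" "v < 1 / 2" for v
  proof -
    have "0 < pshare (3 / 2) v" "pshare (3 / 2) v < v"
      using pshare_less[of v "3 / 2"] pshare_pos[of v "3 / 2"] that by auto
    then show ?thesis
      using that by (simp add: ratio_field_def divide_simps)
  qed
  moreover have "0 < l * u\<^sub>0 \<and> l * u\<^sub>0 < 1 / 2" if "0 < l" "l \<le> 1" for l
    using that u\<^sub>0 mult_right_mono[of l 1 u\<^sub>0] mult_pos_pos[of l u\<^sub>0] by linarith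
  ultimately show "\<exists>L. \<forall>l v. 0 < l \<and> l \<le> 1 \<and> v = 0 + l * (u\<^sub>0 - 0) \<longrightarrow>
      0 < ratio_field 3 v / (0 - v) \<and> ratio_field 3 v / (0 - v) \<le> L"
    by (intro exI[of _ 12]) simp
qed auto

text \<open>The intermediate value theorem yields \<open>z\<close> to the left of 2/5. Convexity
  then spreads the negative value at 2/5 and the zeros at \<open>z\<close> and 1/2 to a full sign
  pattern: positive before \<open>z\<close>, negative between \<open>z\<close> and 1/2.\<close>

lemma exists_attracting_ratio:
  assumes "n \<ge> 4"
  shows "\<exists>z. 0 < z \<and> z < 2 / 5 \<and> ratio_field n z = 0 \<and> attracting_ratio n z"
proof -
  let ?g = "ratio_field n"
  \<comment> \<open>Chosen so that the linear term cancels only half of the constant term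
    \<open>2 * (n - 3)\<close>, which leaves the field positive.\<close>
  define \<epsilon> where "\<epsilon> = (real n - 3) / (8 * real n - 12)"
  have \<epsilon>: "0 < \<epsilon>" "\<epsilon> < 2 / 5"
    using assms by (auto simp: \<epsilon>_def field_simps)
  have "(8 * real n - 12) * \<epsilon> = real n - 3"
    using assms by (simp add: \<epsilon>_def)
  moreover have "0 < 4 * real n * pshare (n / 2) \<epsilon>"
    using pshare_pos[of \<epsilon> "n / 2"] \<epsilon> assms by simp
  ultimately have "0 < ?g \<epsilon>"
    using assms by (simp add: ratio_field_def)
  have neg: "?g (2 / 5) < 0"
    using assms by (rule ratio_field_two_fifths)
  have "continuous_on {\<epsilon>..2 / 5} ?g"
    by (rule continuous_on_subset[OF continuous_on_ratio_field]) (use \<epsilon> in auto)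
  then obtain z where z: "\<epsilon> \<le> z" "z \<le> 2 / 5" "?g z = 0"
    using IVT2'[of ?g "2 / 5" 0 \<epsilon>] \<open>0 < ?g \<epsilon>\<close> neg \<epsilon> by auto
  have "z < 2 / 5"
    using z neg by (cases "z = 2 / 5") auto
  have "0 < z"
    using z \<epsilon> by simp
  have half: "?g (1 / 2) = 0"
    using assms by (simp add: ratio_field_half)
  \<comment> \<open>A nonpositive value at \<open>v\<close> and a negative one at 2/5 would push the
    convex field below zero at \<open>z\<close>.\<close>
  have left: "0 < ?g v" if "0 < v" "v < z" for v
  proof (rule ccontr)
    assume "\<not> 0 < ?g v"
    then have "(2 / 5 - z) * ?g v \<le> 0"
      using \<open>z < 2 / 5\<close> by (simp add: mult_le_0_iff)
    moreover have "(z - v) * ?g (2 / 5) < 0"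
      using that neg by (simp add: mult_less_0_iff)
    ultimately show False
      using ratio_field_convex[of n v z "2 / 5"] that z(3) \<open>z < 2 / 5\<close> assms by simp
  qed
  \<comment> \<open>The field lies below its chords over \<open>[z, 2/5]\<close> and
    \<open>[2/5, 1/2]\<close>, each joining a zero to a negative value.\<close>
  have right: "?g v < 0" if "z < v" "v < 1 / 2" for v
  proof (cases "v \<le> 2 / 5")
    case True
    have "(v - z) * ?g (2 / 5) < 0"
      using that neg by (simp add: mult_less_0_iff)
    then have "(2 / 5 - z) * ?g v < 0"
      using ratio_field_convex[of n z v "2 / 5"] that True z(3) \<open>0 < z\<close> assms by simp
    then show ?thesis
      using \<open>z < 2 / 5\<close> by (simp add: mult_less_0_iff)
  next
    case False
    have "(1 / 2 - v) * ?g (2 / 5) < 0"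
      using that neg by (simp add: mult_less_0_iff)
    then have "(1 / 2 - 2 / 5) * ?g v < 0"
      using ratio_field_convex[of n "2 / 5" v "1 / 2"] that False half assms by simp
    then show ?thesis
      by simp
  qed
  have "attracting_ratio n z"
  proof (rule attracting_ratioI)
    fix u\<^sub>0 :: real assume u\<^sub>0: "0 < u\<^sub>0" "u\<^sub>0 < 1 / 2" "u\<^sub>0 \<noteq> z"
    \<comment> \<open>The quotient is minus the slope of the secant through \<open>v\<close> and
      \<open>z\<close>. By convexity it is largest at the leftmost point, so its value at any point
      left of both \<open>u\<^sub>0\<close> and \<open>z\<close> is a bound. The term
      \<open>z / 2\<close> keeps \<open>a\<close> strictly below \<open>z\<close> when
      \<open>u\<^sub>0\<close> lies to the right.\<close>
    define a where "a = min u\<^sub>0 (z / 2)"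
    have a: "0 < a" "a < z" "a \<le> u\<^sub>0"
      using u\<^sub>0 \<open>0 < z\<close> by (auto simp: a_def)
    show "\<exists>L. \<forall>l v. 0 < l \<and> l \<le> 1 \<and> v = z + l * (u\<^sub>0 - z) \<longrightarrow>
        0 < ?g v / (z - v) \<and> ?g v / (z - v) \<le> L"
    proof (intro exI[of _ "?g a / (z - a)"] allI impI)
      fix l v :: real assume lv: "0 < l \<and> l \<le> 1 \<and> v = z + l * (u\<^sub>0 - z)"
      show "0 < ?g v / (z - v) \<and> ?g v / (z - v) \<le> ?g a / (z - a)"
      proof (cases "u\<^sub>0 < z")
        case True
        then have v: "u\<^sub>0 \<le> v" "v < z"
          using lv mult_right_mono[of l 1 "z - u\<^sub>0"] mult_pos_pos[of l "z - u\<^sub>0"]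
          unfolding right_diff_distrib by linarith+
        have "0 < ?g v"
          using v u\<^sub>0 by (intro left) auto
        have "(z - a) * ?g v \<le> (z - v) * ?g a"
          using ratio_field_convex[of n a v z] assms a v z(3) \<open>z < 2 / 5\<close> by simp
        then show ?thesis
          using v a \<open>0 < ?g v\<close> by (simp add: divide_simps mult.commute)
      next
        case False
        then have v: "z < v" "v \<le> u\<^sub>0"
          using lv u\<^sub>0(3) mult_right_mono[of l 1 "u\<^sub>0 - z"] mult_pos_pos[of l "u\<^sub>0 - z"]
          unfolding right_diff_distrib by linarith+
        have "?g v < 0"
          using v u\<^sub>0 by (intro right) auto
        have "0 \<le> (v - z) * ?g a + (z - a) * ?g v"
          using ratio_field_convex[of n a z v] assms a v u\<^sub>0 z(3) by simp
        then show ?thesis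
          using v a \<open>?g v < 0\<close> by (simp add: divide_simps) (simp add: algebra_simps)
      qed
    qed
  qed (use z \<open>0 < z\<close> \<open>z < 2 / 5\<close> in auto)
  then show ?thesis
    using z \<open>0 < z\<close> \<open>z < 2 / 5\<close> by blast
qed

section \<open>The squared radii\<close>

lemma ring_share_sqrt:
  assumes "0 < a" "0 < b"
  shows "ring_share n (sqrt a) (sqrt b) = a powr (n / 2) / (a powr (n / 2) + b powr (n / 2))"
proof -
  have "sqrt c ^ n = c powr (n / 2)" if "0 < c" for c
    using that by (simp add: powr_half_sqrt[symmetric] powr_power mult.commute)
  with assms show ?thesis
    by (simp add: ring_share_def)
qed

lemma ring_share_pshare:
  assumes "0 < S" "0 < u" "u < 1"
  shows "ring_share n (sqrt (S * u)) (sqrt (S * (1 - u))) = pshare (n / 2) u"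
    and "ring_share n (sqrt (S * (1 - u))) (sqrt (S * u)) = 1 - pshare (n / 2) u"
proof -
  have *: "(S * a) powr p / ((S * a) powr p + (S * b) powr p) = a powr p / (a powr p + b powr p)"
    if "0 < a" "0 < b" for a b p
    using that assms(1) by (simp add: powr_mult distrib_left[symmetric])
  show "ring_share n (sqrt (S * u)) (sqrt (S * (1 - u))) = pshare (n / 2) u"
    using assms by (simp add: ring_share_sqrt * pshare_def)
  show "ring_share n (sqrt (S * (1 - u))) (sqrt (S * u)) = 1 - pshare (n / 2) u"
    using assms *[of "1 - u" u "n / 2"] by (simp add: ring_share_sqrt one_minus_pshare add.commute)
qed

text \<open>This undoes the change of variables: the new time has derivative \<open>1 / S\<close>,
  which cancels the factor \<open>S\<close> when \<open>S * u\<close> is differentiated, and the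
  linear growth of \<open>S\<close> cancels the linear term of \<open>ratio_field\<close>.\<close>

lemma exists_squared_radii:
  assumes n: "n \<ge> 3" and a: "0 < a\<^sub>1" "a\<^sub>1 < a\<^sub>2" and z: "attracting_ratio n z"
  obtains \<rho>\<^sub>1 \<rho>\<^sub>2 :: "real \<Rightarrow> real" where "\<rho>\<^sub>1 0 = a\<^sub>1\<^sup>2" "\<rho>\<^sub>2 0 = a\<^sub>2\<^sup>2"
    "\<And>t. 0 \<le> t \<Longrightarrow> 0 < \<rho>\<^sub>1 t \<and> \<rho>\<^sub>1 t < \<rho>\<^sub>2 t"
    "\<And>t. 0 \<le> t \<Longrightarrow> (\<rho>\<^sub>1 has_real_derivative
      2 * (real n - 3) + 4 * real n * ring_share n (sqrt (\<rho>\<^sub>1 t)) (sqrt (\<rho>\<^sub>2 t))) (at t)"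
    "\<And>t. 0 \<le> t \<Longrightarrow> (\<rho>\<^sub>2 has_real_derivative
      2 * (real n - 3) + 4 * real n * ring_share n (sqrt (\<rho>\<^sub>2 t)) (sqrt (\<rho>\<^sub>1 t))) (at t)"
    "((\<lambda>t. \<rho>\<^sub>1 t / t) \<longlongrightarrow> (8 * real n - 12) * z) at_top"
    "((\<lambda>t. \<rho>\<^sub>2 t / t) \<longlongrightarrow> (8 * real n - 12) * (1 - z)) at_top"
proof -
  define S\<^sub>0 c where "S\<^sub>0 = a\<^sub>1\<^sup>2 + a\<^sub>2\<^sup>2" and "c = 8 * real n - 12"
  have "0 < a\<^sub>1\<^sup>2" "a\<^sub>1\<^sup>2 < a\<^sub>2\<^sup>2"
    using a by (auto simp: power_strict_mono)
  then have "0 < S\<^sub>0" "2 * a\<^sub>1\<^sup>2 < S\<^sub>0"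
    unfolding S\<^sub>0_def by linarith+
  with \<open>0 < a\<^sub>1\<^sup>2\<close> have "0 < a\<^sub>1\<^sup>2 / S\<^sub>0" "a\<^sub>1\<^sup>2 / S\<^sub>0 < 1 / 2"
    by (simp_all add: divide_less_eq)
  \<comment> \<open>The initial fraction lies below 1/2 because the inner ring starts with the
    smaller radius.\<close>
  then obtain u where u: "u 0 = a\<^sub>1\<^sup>2 / S\<^sub>0" "(u \<longlongrightarrow> z) at_top"
    "\<And>t. t \<ge> 0 \<Longrightarrow> (u has_real_derivative ratio_field n (u t)) (at t)"
    "\<And>t. t \<ge> 0 \<Longrightarrow> 0 < u t \<and> u t < 1 / 2"
    using z unfolding attracting_ratio_def by blast
  have "c > 0"
    using n by (simp add: c_def)
  define S where "S t = S\<^sub>0 + c * t" for t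
  define \<tau> where "\<tau> t = ln (S t / S\<^sub>0) / c" for t
  define \<rho>\<^sub>1 \<rho>\<^sub>2 where \<rho>_def: "\<rho>\<^sub>1 t = S t * u (\<tau> t)" "\<rho>\<^sub>2 t = S t * (1 - u (\<tau> t))" for t
  have S_pos: "0 < S t" and \<tau>_nonneg: "0 \<le> \<tau> t" if "0 \<le> t" for t
  proof -
    have "S\<^sub>0 \<le> S t"
      using that \<open>c > 0\<close> by (simp add: S_def)
    then show "0 < S t" "0 \<le> \<tau> t"
      using \<open>0 < S\<^sub>0\<close> \<open>c > 0\<close> by (auto simp: \<tau>_def)
  qed
  have deriv: "(\<rho>\<^sub>1 has_real_derivative c * u (\<tau> t) + ratio_field n (u (\<tau> t))) (at t)"
    "(\<rho>\<^sub>2 has_real_derivative c - (c * u (\<tau> t) + ratio_field n (u (\<tau> t)))) (at t)"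
    if t: "0 \<le> t" for t
  proof -
    have S': "(S has_real_derivative c) (at t)"
      unfolding S_def[abs_def] by (auto intro!: derivative_eq_intros)
    have "((\<lambda>t. ln (S t / S\<^sub>0) / c) has_real_derivative 1 / S t) (at t)"
      using S_pos[OF t] \<open>0 < S\<^sub>0\<close> \<open>0 < c\<close> by (auto intro!: derivative_eq_intros S')
    then have "(\<tau> has_real_derivative 1 / S t) (at t)"
      by (simp add: \<tau>_def[abs_def])
    from DERIV_chain2[OF u(3)[OF \<tau>_nonneg[OF t]] this]
    have u': "((\<lambda>t. u (\<tau> t)) has_real_derivative ratio_field n (u (\<tau> t)) * (1 / S t)) (at t)" .
    show "(\<rho>\<^sub>1 has_real_derivative c * u (\<tau> t) + ratio_field n (u (\<tau> t))) (at t)"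
      unfolding \<rho>_def[abs_def] using S_pos[OF t]
      by (auto intro!: derivative_eq_intros S' u')
    show "(\<rho>\<^sub>2 has_real_derivative c - (c * u (\<tau> t) + ratio_field n (u (\<tau> t)))) (at t)"
      unfolding \<rho>_def[abs_def] using S_pos[OF t]
      by (auto intro!: derivative_eq_intros S' u' simp: algebra_simps)
  qed
  have lim_S: "((\<lambda>t. S t / t) \<longlongrightarrow> c) at_top"
  proof (rule Lim_transform_eventually)
    have "((\<lambda>t. S\<^sub>0 * inverse t + c) \<longlongrightarrow> S\<^sub>0 * 0 + c) at_top"
      by (intro tendsto_intros tendsto_inverse_0_at_top filterlim_ident)
    then show "((\<lambda>t. S\<^sub>0 * inverse t + c) \<longlongrightarrow> c) at_top"
      by simp
    show "eventually (\<lambda>t. S\<^sub>0 * inverse t + c = S t / t) at_top"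
      using eventually_gt_at_top[of 0] by eventually_elim (simp add: S_def field_simps)
  qed
  have lim_u: "((\<lambda>t. u (\<tau> t)) \<longlongrightarrow> z) at_top"
  proof (rule filterlim_compose[OF u(2)])
    have "filterlim S at_top at_top"
      unfolding S_def[abs_def] using \<open>c > 0\<close>
      by (intro filterlim_tendsto_add_at_top[OF tendsto_const]
          filterlim_tendsto_pos_mult_at_top[OF tendsto_const]) (auto intro: filterlim_ident)
    then have "filterlim (\<lambda>t. inverse S\<^sub>0 * S t) at_top at_top"
      using \<open>0 < S\<^sub>0\<close> by (intro filterlim_tendsto_pos_mult_at_top[OF tendsto_const]) auto
    then have "filterlim (\<lambda>t. ln (inverse S\<^sub>0 * S t)) at_top at_top"
      by (rule filterlim_compose[OF ln_at_top])
    then have "filterlim (\<lambda>t. inverse c * ln (inverse S\<^sub>0 * S t)) at_top at_top"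
      using \<open>0 < c\<close> by (intro filterlim_tendsto_pos_mult_at_top[OF tendsto_const]) auto
    then show "filterlim \<tau> at_top at_top"
      by (simp add: \<tau>_def[abs_def] divide_inverse mult.commute)
  qed
  have "((\<lambda>t. S t / t * u (\<tau> t)) \<longlongrightarrow> c * z) at_top"
    "((\<lambda>t. S t / t * (1 - u (\<tau> t))) \<longlongrightarrow> c * (1 - z)) at_top"
    by (intro tendsto_intros lim_S lim_u)+
  then have lim: "((\<lambda>t. \<rho>\<^sub>1 t / t) \<longlongrightarrow> (8 * real n - 12) * z) at_top"
    "((\<lambda>t. \<rho>\<^sub>2 t / t) \<longlongrightarrow> (8 * real n - 12) * (1 - z)) at_top"
    by (simp_all add: \<rho>_def c_def)
  have u_\<tau>: "0 < u (\<tau> t)" "u (\<tau> t) < 1 / 2" if "0 \<le> t" for t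
    using u(4)[OF \<tau>_nonneg[OF that]] by auto
  have pos: "0 < \<rho>\<^sub>1 t \<and> \<rho>\<^sub>1 t < \<rho>\<^sub>2 t" if "0 \<le> t" for t
    using S_pos[OF that] u_\<tau>[OF that] by (simp add: \<rho>_def)
  have ode: "(\<rho>\<^sub>1 has_real_derivative
      2 * (real n - 3) + 4 * real n * ring_share n (sqrt (\<rho>\<^sub>1 t)) (sqrt (\<rho>\<^sub>2 t))) (at t)"
    "(\<rho>\<^sub>2 has_real_derivative
      2 * (real n - 3) + 4 * real n * ring_share n (sqrt (\<rho>\<^sub>2 t)) (sqrt (\<rho>\<^sub>1 t))) (at t)"
    if "0 \<le> t" for t
  proof -
    have shares: "ring_share n (sqrt (\<rho>\<^sub>1 t)) (sqrt (\<rho>\<^sub>2 t)) = pshare (n / 2) (u (\<tau> t))"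
      "ring_share n (sqrt (\<rho>\<^sub>2 t)) (sqrt (\<rho>\<^sub>1 t)) = 1 - pshare (n / 2) (u (\<tau> t))"
      unfolding \<rho>_def using S_pos[OF that] u_\<tau>[OF that] by (intro ring_share_pshare; simp)+
    show "(\<rho>\<^sub>1 has_real_derivative
        2 * (real n - 3) + 4 * real n * ring_share n (sqrt (\<rho>\<^sub>1 t)) (sqrt (\<rho>\<^sub>2 t))) (at t)"
      unfolding shares by (rule DERIV_cong[OF deriv(1)[OF that]]) (simp add: c_def ratio_field_def)
    show "(\<rho>\<^sub>2 has_real_derivative
        2 * (real n - 3) + 4 * real n * ring_share n (sqrt (\<rho>\<^sub>2 t)) (sqrt (\<rho>\<^sub>1 t))) (at t)"
      unfolding shares
      by (rule DERIV_cong[OF deriv(2)[OF that]]) (simp add: c_def ratio_field_def algebra_simps)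
  qed
  have "\<tau> 0 = 0" "S 0 = S\<^sub>0"
    using \<open>0 < S\<^sub>0\<close> by (simp_all add: \<tau>_def S_def)
  moreover have "S\<^sub>0 * u 0 = a\<^sub>1\<^sup>2"
    using \<open>0 < S\<^sub>0\<close> u(1) by simp
  ultimately have "\<rho>\<^sub>1 0 = a\<^sub>1\<^sup>2" "\<rho>\<^sub>2 0 = a\<^sub>2\<^sup>2"
    by (simp_all add: \<rho>_def right_diff_distrib) (simp add: S\<^sub>0_def)
  then show ?thesis
    by (rule that[of \<rho>\<^sub>1 \<rho>\<^sub>2, OF _ _ pos ode lim])
qed

section \<open>Asymptotics of the radii and of the limiting constants\<close>

lemma asymp_equiv_linear:
  fixes f :: "real \<Rightarrow> real"
  assumes "((\<lambda>t. f t / t) \<longlongrightarrow> c) at_top" "c \<noteq> 0"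
  shows "f \<sim>[at_top] (\<lambda>t. c * t)"
proof (rule asymp_equivI')
  have "((\<lambda>t. f t / t / c) \<longlongrightarrow> c / c) at_top"
    using assms by (intro tendsto_intros)
  then show "((\<lambda>t. f t / (c * t)) \<longlongrightarrow> 1) at_top"
    using assms(2) by (simp add: mult.commute)
qed

text \<open>For \<open>n = 3\<close> the difference of the reciprocal radii is conserved.\<close>

lemma three_inner_radius_limit:
  fixes \<rho>\<^sub>1 \<rho>\<^sub>2 :: "real \<Rightarrow> real"
  assumes a: "0 < a\<^sub>1" "a\<^sub>1 < a\<^sub>2" "\<rho>\<^sub>1 0 = a\<^sub>1\<^sup>2" "\<rho>\<^sub>2 0 = a\<^sub>2\<^sup>2"
    and pos: "\<And>t. 0 \<le> t \<Longrightarrow> 0 < \<rho>\<^sub>1 t \<and> \<rho>\<^sub>1 t < \<rho>\<^sub>2 t"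
    and \<rho>\<^sub>1: "\<And>t. 0 \<le> t \<Longrightarrow>
      (\<rho>\<^sub>1 has_real_derivative 12 * ring_share 3 (sqrt (\<rho>\<^sub>1 t)) (sqrt (\<rho>\<^sub>2 t))) (at t)"
    and \<rho>\<^sub>2: "\<And>t. 0 \<le> t \<Longrightarrow>
      (\<rho>\<^sub>2 has_real_derivative 12 * ring_share 3 (sqrt (\<rho>\<^sub>2 t)) (sqrt (\<rho>\<^sub>1 t))) (at t)"
    and lim: "filterlim \<rho>\<^sub>2 at_top at_top"
  shows "\<rho>\<^sub>1 \<sim>[at_top] (\<lambda>t. (a\<^sub>1 * a\<^sub>2 / (a\<^sub>2 - a\<^sub>1))\<^sup>2)"
proof -
  let ?I = "\<lambda>t. 1 / sqrt (\<rho>\<^sub>1 t) - 1 / sqrt (\<rho>\<^sub>2 t)"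
  \<comment> \<open>The initial value of the conserved difference; it becomes the limit of the
    reciprocal inner radius, since the outer radius tends to infinity.\<close>
  define k where "k = (a\<^sub>2 - a\<^sub>1) / (a\<^sub>1 * a\<^sub>2)"
  have "k > 0"
    using a by (simp add: k_def)
  \<comment> \<open>The cube in the numerator of the share cancels against the chain rule. What is
    left is symmetric in the two radii, so the two derivatives coincide.\<close>
  have recip: "((\<lambda>t. 1 / sqrt (\<rho> t)) has_real_derivative - (6 / (sqrt (\<rho> t) ^ 3 + s ^ 3))) (at t)"
    if "(\<rho> has_real_derivative 12 * ring_share 3 (sqrt (\<rho> t)) s) (at t)" "0 < \<rho> t" "0 < s" for \<rho> s t
  proof -
    define r where "r = sqrt (\<rho> t)"
    have "0 < r"
      using that by (simp add: r_def)
    then have "r ^ 3 + s ^ 3 > 0"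
      using that by (simp add: add_pos_pos)
    have "((\<lambda>t. 1 / sqrt (\<rho> t)) has_real_derivative
        - (12 * ring_share 3 r s / (2 * r) / (r * r))) (at t)"
      using that \<open>0 < r\<close> unfolding r_def
      by (auto intro!: derivative_eq_intros simp: field_simps)
    also have "12 * ring_share 3 r s / (2 * r) / (r * r) = 6 / (r ^ 3 + s ^ 3)"
      using \<open>0 < r\<close> \<open>r ^ 3 + s ^ 3 > 0\<close> by (simp add: ring_share_def power3_eq_cube divide_simps)
    finally show ?thesis
      by (simp add: r_def)
  qed
  have deriv: "(?I has_real_derivative 0) (at t)" if "0 \<le> t" for t
    using DERIV_diff[OF recip[OF \<rho>\<^sub>1[OF that]] recip[OF \<rho>\<^sub>2[OF that]]] pos[OF that]
    by (simp add: add.commute)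
  have "?I t = k" if "0 \<le> t" for t
  proof -
    have "?I t = ?I 0"
      by (rule has_field_derivative_zero_constant[of "{0..}", THEN exE])
        (use that deriv in \<open>auto intro: has_field_derivative_at_within\<close>)
    also have "?I 0 = k"
      using a by (simp add: k_def field_simps)
    finally show ?thesis .
  qed
  then have "eventually (\<lambda>t. k + 1 / sqrt (\<rho>\<^sub>2 t) = 1 / sqrt (\<rho>\<^sub>1 t)) at_top"
    by (intro eventually_mono[OF eventually_ge_at_top[of 0]]) (simp add: algebra_simps)
  moreover have "((\<lambda>t. k + 1 / sqrt (\<rho>\<^sub>2 t)) \<longlongrightarrow> k + 0) at_top"
    unfolding divide_inverse mult_1_left
    by (intro tendsto_intros tendsto_inverse_0_at_top filterlim_compose[OF sqrt_at_top lim])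
  ultimately have "((\<lambda>t. 1 / sqrt (\<rho>\<^sub>1 t)) \<longlongrightarrow> k) at_top"
    by (simp add: Lim_transform_eventually)
  then have "((\<lambda>t. inverse ((1 / sqrt (\<rho>\<^sub>1 t))\<^sup>2) * k\<^sup>2) \<longlongrightarrow> inverse (k\<^sup>2) * k\<^sup>2) at_top"
    using \<open>k > 0\<close> by (intro tendsto_intros) auto
  moreover have "eventually (\<lambda>t. inverse ((1 / sqrt (\<rho>\<^sub>1 t))\<^sup>2) * k\<^sup>2 =
      \<rho>\<^sub>1 t / (a\<^sub>1 * a\<^sub>2 / (a\<^sub>2 - a\<^sub>1))\<^sup>2) at_top"
    using eventually_ge_at_top[of 0]
  proof eventually_elim
    case (elim t)
    have "k = inverse (a\<^sub>1 * a\<^sub>2 / (a\<^sub>2 - a\<^sub>1))"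
      by (simp add: k_def)
    with pos[OF elim] show ?case
      by (simp only: power_inverse divide_inverse) (simp add: power_inverse)
  qed
  ultimately show ?thesis
    using \<open>k > 0\<close> by (intro asymp_equivI') (auto intro: Lim_transform_eventually)
qed

text \<open>Stationarity of \<open>z n\<close> expresses \<open>\<alpha> n\<close> as
  \<open>2 * (n - 3)\<close> plus \<open>4 * n\<close> times the share. As
  \<open>z n < 2 / 5\<close>, the share is at most the \<open>n / 2\<close>-th power of 2/3, which
  decays faster than \<open>n\<close> grows.\<close>

lemma growth_constants:
  fixes z :: "nat \<Rightarrow> real"
  assumes z: "\<forall>n\<ge>4. 0 < z n \<and> z n < 2 / 5 \<and> ratio_field n (z n) = 0"
  defines "\<alpha> \<equiv> \<lambda>n. (8 * real n - 12) * z n" and "\<beta> \<equiv> \<lambda>n. (8 * real n - 12) * (1 - z n)"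
  shows "\<And>n. n \<ge> 4 \<Longrightarrow> 0 < \<alpha> n \<and> \<alpha> n < \<beta> n \<and> \<alpha> n + \<beta> n = 8 * real n - 12 \<and>
      \<beta> n - \<alpha> n = 4 * real n * ((\<beta> n powr (real n / 2) - \<alpha> n powr (real n / 2)) /
        (\<beta> n powr (real n / 2) + \<alpha> n powr (real n / 2)))"
    and "(\<lambda>n. \<alpha> n - (2 * real n - 6)) \<longlonglongrightarrow> 0" and "(\<lambda>n. \<beta> n - (6 * real n - 6)) \<longlonglongrightarrow> 0"
proof -
  have \<alpha>: "\<alpha> n = 2 * (real n - 3) + 4 * real n * pshare (n / 2) (z n)" if "n \<ge> 4" for n
    using z that by (simp add: \<alpha>_def ratio_field_def)
  have sum: "\<alpha> n + \<beta> n = 8 * real n - 12" for n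
    by (simp add: \<alpha>_def \<beta>_def algebra_simps)
  show "0 < \<alpha> n \<and> \<alpha> n < \<beta> n \<and> \<alpha> n + \<beta> n = 8 * real n - 12 \<and>
      \<beta> n - \<alpha> n = 4 * real n * ((\<beta> n powr (real n / 2) - \<alpha> n powr (real n / 2)) /
        (\<beta> n powr (real n / 2) + \<alpha> n powr (real n / 2)))" if n: "n \<ge> 4" for n
  proof (intro conjI sum)
    define c where "c = 8 * real n - 12"
    have "c > 0"
      using n by (simp add: c_def)
    show "0 < \<alpha> n" "\<alpha> n < \<beta> n"
      using \<open>c > 0\<close> z n by (auto simp: \<alpha>_def \<beta>_def c_def[symmetric])
    define P Q where "P = z n powr (n / 2)" and "Q = (1 - z n) powr (n / 2)"
    have "P > 0" "Q > 0"
      using z n by (auto simp: P_def Q_def)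
    have "\<beta> n - \<alpha> n = 4 * real n * (1 - 2 * pshare (n / 2) (z n))"
      using \<alpha>[OF n] sum[of n] by (simp add: algebra_simps)
    also have "1 - 2 * pshare (n / 2) (z n) = (Q - P) / (Q + P)"
      using \<open>P > 0\<close> \<open>Q > 0\<close> by (simp add: pshare_def P_def[symmetric] Q_def[symmetric] field_simps)
    \<comment> \<open>Expanding by this power of \<open>c\<close> passes from the fractions
      \<open>z n\<close> and \<open>1 - z n\<close> to the constants themselves.\<close>
    also have "\<dots> = (c powr (n / 2) * Q - c powr (n / 2) * P) / (c powr (n / 2) * Q + c powr (n / 2) * P)"
      using \<open>c > 0\<close> by (simp add: distrib_left[symmetric] right_diff_distrib[symmetric])
    also have "c powr (n / 2) * Q = \<beta> n powr (n / 2)"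
      using \<open>c > 0\<close> z n by (simp add: \<beta>_def c_def[symmetric] Q_def powr_mult)
    also have "c powr (n / 2) * P = \<alpha> n powr (n / 2)"
      using \<open>c > 0\<close> z n by (simp add: \<alpha>_def c_def[symmetric] P_def powr_mult)
    finally show "\<beta> n - \<alpha> n = 4 * real n * ((\<beta> n powr (real n / 2) - \<alpha> n powr (real n / 2)) /
        (\<beta> n powr (real n / 2) + \<alpha> n powr (real n / 2)))" .
  qed
  have "(\<lambda>n. 4 * (real n * sqrt (2 / 3) ^ n)) \<longlonglongrightarrow> 4 * 0"
    by (intro tendsto_intros powser_times_n_limit_0) (simp add: real_sqrt_lt_1_iff)
  moreover have "eventually (\<lambda>n. norm (\<alpha> n - (2 * real n - 6)) \<le> 4 * (real n * sqrt (2 / 3) ^ n)) sequentially"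
    using eventually_ge_at_top[of 4]
  proof eventually_elim
    case (elim n)
    note z = z[rule_format, OF elim]
    have "pshare (n / 2) (z n) \<le> (z n / (1 - z n)) powr (n / 2)"
      using z by (intro pshare_le_ratio) auto
    also have "\<dots> \<le> (2 / 3) powr (n / 2)"
      using z by (intro powr_mono2) (auto simp: field_simps)
    also have "\<dots> = sqrt (2 / 3) ^ n"
      by (simp only: powr_half_sqrt[symmetric]) (simp add: powr_power)
    finally have "4 * real n * pshare (n / 2) (z n) \<le> 4 * real n * sqrt (2 / 3) ^ n"
      by (intro mult_left_mono) auto
    moreover have "0 \<le> 4 * real n * pshare (n / 2) (z n)"
      using z pshare_pos[of "z n" "n / 2"] by simp
    ultimately show ?case
      using \<alpha>[OF elim] by (simp add: mult.assoc)
  qed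
  ultimately show lim: "(\<lambda>n. \<alpha> n - (2 * real n - 6)) \<longlonglongrightarrow> 0"
    unfolding mult_zero_right by (rule Lim_null_comparison[rotated])
  have "\<beta> n - (6 * real n - 6) = - (\<alpha> n - (2 * real n - 6))" for n
    using sum[of n] by linarith
  then show "(\<lambda>n. \<beta> n - (6 * real n - 6)) \<longlonglongrightarrow> 0"
    using tendsto_minus[OF lim] by (simp only: minus_zero)
qed

section \<open>Collisions\<close>

lemma isCont_two_ring:
  assumes "isCont r\<^sub>1 t" "isCont r\<^sub>2 t"
  shows "isCont (\<lambda>t. two_ring n \<theta> (r\<^sub>1 t) (r\<^sub>2 t) j) t"
proof -
  consider "j \<le> n" | "n < j" "j \<le> 2 * n" | "2 * n < j"
    by linarith
  then show ?thesis
    using assms by cases (auto simp: two_ring_def)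
qed

text \<open>
  For \<open>n = 2\<close> and \<open>s = \<rho>\<^sub>1 + \<rho>\<^sub>2\<close> the equation is \<open>d\<rho>\<^sub>1 / ds = 2 \<rho>\<^sub>1 / s - 1 / 2\<close>, with the solutions
  \<open>\<rho>\<^sub>1 = s / 2 + C s\<^sup>2\<close>.
\<close>

lemma two_collision_radii:
  fixes a\<^sub>1 a\<^sub>2 :: real
  assumes a: "0 < a\<^sub>1" "a\<^sub>1 < a\<^sub>2"
  obtains T and \<rho>\<^sub>1 \<rho>\<^sub>2 :: "real \<Rightarrow> real" where "0 < T" "\<rho>\<^sub>1 0 = a\<^sub>1\<^sup>2" "\<rho>\<^sub>2 0 = a\<^sub>2\<^sup>2"
    "\<And>t. isCont \<rho>\<^sub>1 t" "\<And>t. isCont \<rho>\<^sub>2 t" "\<rho>\<^sub>1 T = 0" "0 < \<rho>\<^sub>2 T"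
    "\<And>t. 0 \<le> t \<Longrightarrow> t < T \<Longrightarrow> 0 < \<rho>\<^sub>1 t \<and> \<rho>\<^sub>1 t < \<rho>\<^sub>2 t"
    "\<And>t. 0 \<le> t \<Longrightarrow> t < T \<Longrightarrow> (\<rho>\<^sub>1 has_real_derivative
      2 * (real 2 - 3) + 4 * real 2 * ring_share 2 (sqrt (\<rho>\<^sub>1 t)) (sqrt (\<rho>\<^sub>2 t))) (at t)"
    "\<And>t. 0 \<le> t \<Longrightarrow> t < T \<Longrightarrow> (\<rho>\<^sub>2 has_real_derivative
      2 * (real 2 - 3) + 4 * real 2 * ring_share 2 (sqrt (\<rho>\<^sub>2 t)) (sqrt (\<rho>\<^sub>1 t))) (at t)"
proof -
  define S\<^sub>0 d where "S\<^sub>0 = a\<^sub>1\<^sup>2 + a\<^sub>2\<^sup>2" and "d = a\<^sub>2\<^sup>2 - a\<^sub>1\<^sup>2"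
  have "0 < a\<^sub>1\<^sup>2" "a\<^sub>1\<^sup>2 < a\<^sub>2\<^sup>2"
    using a by (auto simp: power_strict_mono)
  then have "0 < S\<^sub>0" "0 < d" "d < S\<^sub>0"
    unfolding S\<^sub>0_def d_def by linarith+
  define S where "S t = S\<^sub>0 + 4 * t" for t
  \<comment> \<open>Half the difference of the squared radii; the initial data fix the coefficient
    \<open>C\<close> as \<open>- d / (2 * S\<^sub>0\<^sup>2)\<close>. The resulting radii are
    polynomials in \<open>t\<close>, so their left limits at the collision are simply their
    values.\<close>
  define \<delta> where "\<delta> t = d * (S t)\<^sup>2 / (2 * S\<^sub>0\<^sup>2)" for t
  define \<rho>\<^sub>1 \<rho>\<^sub>2 where \<rho>_def: "\<rho>\<^sub>1 t = S t / 2 - \<delta> t" "\<rho>\<^sub>2 t = S t / 2 + \<delta> t" for t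
  \<comment> \<open>The inner radius vanishes when \<open>\<delta> t = S t / 2\<close>, that is,
    when \<open>S t = S\<^sub>0\<^sup>2 / d\<close>.\<close>
  define T where "T = (S\<^sub>0\<^sup>2 / d - S\<^sub>0) / 4"
  have "S\<^sub>0 * 1 < S\<^sub>0 * (S\<^sub>0 / d)"
    using \<open>0 < S\<^sub>0\<close> \<open>0 < d\<close> \<open>d < S\<^sub>0\<close> by (intro mult_strict_left_mono) auto
  then have "0 < T"
    by (simp add: T_def power2_eq_square)
  have "S\<^sub>0 + 4 * ((x - S\<^sub>0) / 4) = x" for x
    by (simp add: field_simps)
  then have S_T: "S T = S\<^sub>0\<^sup>2 / d"
    by (simp only: S_def T_def)
  then have \<delta>_T: "\<delta> T = S T / 2"
    using \<open>0 < S\<^sub>0\<close> \<open>0 < d\<close> by (simp add: \<delta>_def power2_eq_square)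
  have S_pos: "0 < S t" if "0 \<le> t" for t
    using that \<open>0 < S\<^sub>0\<close> by (simp add: S_def)
  have "0 < S T"
    using \<open>0 < T\<close> by (intro S_pos) simp
  have \<delta>': "(\<delta> has_real_derivative 4 * d * S t / S\<^sub>0\<^sup>2) (at t)" for t
  proof -
    have "((\<lambda>t. d * (S t)\<^sup>2) has_real_derivative d * (8 * S t)) (at t)"
      unfolding S_def by (auto intro!: derivative_eq_intros)
    from DERIV_cdivide[OF this, of "2 * S\<^sub>0\<^sup>2"] show ?thesis
      unfolding \<delta>_def[abs_def] by (rule DERIV_cong) (use \<open>0 < S\<^sub>0\<close> in \<open>simp add: divide_simps\<close>)
  qed
  have S': "((\<lambda>t. S t / 2) has_real_derivative 2) (at t)" for t
    unfolding S_def by (auto intro!: derivative_eq_intros)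
  have \<rho>': "(\<rho>\<^sub>1 has_real_derivative 2 - 4 * d * S t / S\<^sub>0\<^sup>2) (at t)"
    "(\<rho>\<^sub>2 has_real_derivative 2 + 4 * d * S t / S\<^sub>0\<^sup>2) (at t)" for t
    unfolding \<rho>_def[abs_def] by (rule DERIV_diff[OF S' \<delta>'] DERIV_add[OF S' \<delta>'])+
  have pos: "0 < \<rho>\<^sub>1 t \<and> \<rho>\<^sub>1 t < \<rho>\<^sub>2 t" if "0 \<le> t" "t < T" for t
  proof -
    have "S t < S\<^sub>0\<^sup>2 / d"
      using that S_T[symmetric] by (simp add: S_def)
    then have "d * S t < S\<^sub>0\<^sup>2"
      using \<open>0 < d\<close> by (simp add: field_simps)
    then have "d * S t * S t < S\<^sub>0\<^sup>2 * S t"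
      using S_pos[OF that(1)] by simp
    then have "\<delta> t < S t / 2"
      using \<open>0 < S\<^sub>0\<close> by (simp add: \<delta>_def power2_eq_square field_simps)
    moreover have "0 < \<delta> t"
      using S_pos[OF that(1)] \<open>0 < d\<close> \<open>0 < S\<^sub>0\<close> by (simp add: \<delta>_def)
    ultimately show ?thesis
      by (simp add: \<rho>_def)
  qed
  have ode: "(\<rho>\<^sub>1 has_real_derivative
      2 * (real 2 - 3) + 4 * real 2 * ring_share 2 (sqrt (\<rho>\<^sub>1 t)) (sqrt (\<rho>\<^sub>2 t))) (at t)"
    "(\<rho>\<^sub>2 has_real_derivative
      2 * (real 2 - 3) + 4 * real 2 * ring_share 2 (sqrt (\<rho>\<^sub>2 t)) (sqrt (\<rho>\<^sub>1 t))) (at t)"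
    if t: "0 \<le> t" "t < T" for t
  proof -
    have "\<rho>\<^sub>1 t + \<rho>\<^sub>2 t = S t"
      by (simp add: \<rho>_def)
    moreover have "\<delta> t / S t = d * S t / (2 * S\<^sub>0\<^sup>2)"
      using S_pos[OF t(1)] by (simp add: \<delta>_def power2_eq_square)
    ultimately have "ring_share 2 (sqrt (\<rho>\<^sub>1 t)) (sqrt (\<rho>\<^sub>2 t)) = 1 / 2 - d * S t / (2 * S\<^sub>0\<^sup>2)"
      "ring_share 2 (sqrt (\<rho>\<^sub>2 t)) (sqrt (\<rho>\<^sub>1 t)) = 1 / 2 + d * S t / (2 * S\<^sub>0\<^sup>2)"
      using pos[OF t] S_pos[OF t(1)]
      by (simp_all add: ring_share_def add.commute) (simp_all add: \<rho>_def diff_divide_distrib add_divide_distrib)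
    note shares = this
    show "(\<rho>\<^sub>1 has_real_derivative
        2 * (real 2 - 3) + 4 * real 2 * ring_share 2 (sqrt (\<rho>\<^sub>1 t)) (sqrt (\<rho>\<^sub>2 t))) (at t)"
      "(\<rho>\<^sub>2 has_real_derivative
        2 * (real 2 - 3) + 4 * real 2 * ring_share 2 (sqrt (\<rho>\<^sub>2 t)) (sqrt (\<rho>\<^sub>1 t))) (at t)"
      unfolding shares by (rule DERIV_cong[OF \<rho>'(1)] DERIV_cong[OF \<rho>'(2)]; simp add: algebra_simps)+
  qed
  have "\<delta> 0 = d / 2"
    using \<open>0 < S\<^sub>0\<close> by (simp add: \<delta>_def S_def)
  then have "\<rho>\<^sub>1 0 = a\<^sub>1\<^sup>2" "\<rho>\<^sub>2 0 = a\<^sub>2\<^sup>2"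
    by (simp_all add: \<rho>_def S_def S\<^sub>0_def d_def field_simps)
  then show ?thesis
    using that[of T \<rho>\<^sub>1 \<rho>\<^sub>2] \<open>0 < T\<close> \<rho>'[THEN DERIV_isCont] pos ode \<delta>_T \<open>0 < S T\<close>
    by (auto simp: \<rho>_def(1)[of T] \<rho>_def(2)[of T])
qed

section \<open>The end of the lifetime and collision clusters\<close>

lemma vortex_solution_isCont:
  assumes "vortex_solution N m y T x" "0 < t" "ereal t < T" "j \<in> {1..N}"
  shows "isCont (x j) t"
  using assms unfolding vortex_solution_def
  by (intro has_vector_derivative_continuous) blast

lemma tendsto_at_left_unique:
  fixes f :: "real \<Rightarrow> 'a::t2_space"
  shows "(f \<longlongrightarrow> a) (at_left t) \<Longrightarrow> (f \<longlongrightarrow> b) (at_left t) \<Longrightarrow> a = b"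
  by (rule tendsto_unique[rotated]) auto

lemma isCont_tendsto_at_left: "isCont f t \<Longrightarrow> (f \<longlongrightarrow> f t) (at_left (t :: real))"
  unfolding isCont_def by (rule tendsto_mono[OF at_le]) auto

lemma eventually_at_left_nonneg:
  assumes "0 < (t :: real)"
  shows "eventually (\<lambda>s. 0 \<le> s \<and> s < t) (at_left t)"
  unfolding eventually_at_left_field using assms by (intro exI[of _ 0]) auto

text \<open>A longer solution would have a limit at \<open>T\<close> in which two vortices coincide.\<close>

lemma the_vortex_solution_until_collision:
  assumes x: "vortex_solution N m y (ereal T) x" and "0 < T"
    and jl: "j \<in> {1..N}" "l \<in> {1..N}" "j \<noteq> l"
    and lim: "(x j \<longlongrightarrow> p) (at_left T)" "(x l \<longlongrightarrow> p) (at_left T)"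
  shows "the_vortex_solution N m y (ereal T) x"
  unfolding the_vortex_solution_def
proof (intro conjI allI impI ballI)
  fix T' x' assume x': "vortex_solution N m y T' x'"
  show le: "T' \<le> ereal T"
  proof (rule ccontr)
    assume "\<not> T' \<le> ereal T"
    then have "ereal T < T'"
      by simp
    have "x' i T = p" if "i \<in> {1..N}" "(x i \<longlongrightarrow> p) (at_left T)" for i
    proof (rule tendsto_at_left_unique)
      show "(x' i \<longlongrightarrow> x' i T) (at_left T)"
        using vortex_solution_isCont[OF x' \<open>0 < T\<close> \<open>ereal T < T'\<close> that(1)] by (rule isCont_tendsto_at_left)
      show "(x' i \<longlongrightarrow> p) (at_left T)"
      proof (rule Lim_transform_eventually[OF that(2)])
        show "eventually (\<lambda>t. x i t = x' i t) (at_left T)"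
          using eventually_at_left_nonneg[OF \<open>0 < T\<close>]
        proof eventually_elim
          case (elim t)
          then show ?case
            using vortex_solution_unique[OF x x' _ _ ereal_le_less_trans[OF _ \<open>ereal T < T'\<close>] that(1)]
            by simp
        qed
      qed
    qed
    then have "x' j T = x' l T"
      using jl lim by simp
    moreover have "x' j T \<noteq> x' l T"
      using x' jl \<open>0 < T\<close> \<open>ereal T < T'\<close> unfolding vortex_solution_def by simp
    ultimately show False by simp
  qed
  fix i t assume "i \<in> {1..N}" "0 \<le> t \<and> ereal t < T'"
  then show "x' i t = x i t"
    using vortex_solution_unique[OF x' x] le by (meson less_le_trans)
qed (rule x)

text \<open>Collisions are impossible within the lifetime, so a cluster can only form at its end.
  There the positive limiting distances to outside vortices make the cluster a full fibre of the
  limit configuration.\<close>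

lemma collision_cluster_at_iff:
  assumes x: "vortex_solution N m y (ereal T) x"
    and lim: "\<And>j. j \<in> {1..N} \<Longrightarrow> (x j \<longlongrightarrow> P j) (at_left T)"
  shows "collision_cluster_at N (ereal T) x I T\<^sub>c p \<longleftrightarrow>
    T\<^sub>c = T \<and> I = {j \<in> {1..N}. P j = p} \<and> 2 \<le> card I"
proof
  have "0 < T"
    using x by (simp add: vortex_solution_def)
  assume cl: "collision_cluster_at N (ereal T) x I T\<^sub>c p"
  then have I: "I \<subseteq> {1..N}" "2 \<le> card I" "0 < T\<^sub>c" "T\<^sub>c \<le> T"
    and lim_I: "\<And>j. j \<in> I \<Longrightarrow> (x j \<longlongrightarrow> p) (at_left T\<^sub>c)"
    and lim_out: "\<And>j l. j \<in> I \<Longrightarrow> l \<in> {1..N} - I \<Longrightarrow>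
      \<exists>d>0. ((\<lambda>t. dist (x j t) (x l t)) \<longlongrightarrow> d) (at_left T\<^sub>c)"
    by (auto simp: collision_cluster_at_def)
  obtain j l where jl: "j \<in> I" "l \<in> I" "j \<noteq> l"
    using I(2) by (metis One_nat_def Suc_1 card_le_Suc0_iff_eq card.infinite not_less_eq_eq
        not_numeral_le_zero)
  \<comment> \<open>At an earlier time continuity would place the two members \<open>j\<close> and
    \<open>l\<close> at the same point, although a solution is free of collisions.\<close>
  have "T\<^sub>c = T"
  proof (rule ccontr)
    assume "T\<^sub>c \<noteq> T"
    then have "ereal T\<^sub>c < ereal T"
      using I by simp
    have "x i T\<^sub>c = p" if "i \<in> I" for i
      using vortex_solution_isCont[OF x I(3) \<open>ereal T\<^sub>c < ereal T\<close>, of i] that I(1) lim_I[OF that]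
      by (blast intro: tendsto_at_left_unique isCont_tendsto_at_left)
    moreover have "x j T\<^sub>c \<noteq> x l T\<^sub>c"
      using x jl I \<open>ereal T\<^sub>c < ereal T\<close> unfolding vortex_solution_def by (simp add: subset_eq)
    ultimately show False
      using jl by simp
  qed
  have P_I: "P i = p" if "i \<in> I" for i
    using lim[of i] lim_I[OF that] that I(1) unfolding \<open>T\<^sub>c = T\<close>
    by (blast intro: tendsto_at_left_unique)
  have "P i \<noteq> p" if i: "i \<in> {1..N} - I" for i
  proof -
    from lim_out[OF jl(1) i] obtain d where d: "0 < d"
      "((\<lambda>t. dist (x j t) (x i t)) \<longlongrightarrow> d) (at_left T)"
      unfolding \<open>T\<^sub>c = T\<close> by blast
    have "((\<lambda>t. dist (x j t) (x i t)) \<longlongrightarrow> dist (P j) (P i)) (at_left T)"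
      using lim jl(1) I(1) i by (intro tendsto_dist) auto
    with d have "0 < dist (P j) (P i)"
      using tendsto_at_left_unique by blast
    then show ?thesis
      using P_I[OF jl(1)] by auto
  qed
  then have "I = {j \<in> {1..N}. P j = p}"
    using P_I I(1) by blast
  then show "T\<^sub>c = T \<and> I = {j \<in> {1..N}. P j = p} \<and> 2 \<le> card I"
    using \<open>T\<^sub>c = T\<close> I by blast
next
  have "0 < T"
    using x by (simp add: vortex_solution_def)
  assume I: "T\<^sub>c = T \<and> I = {j \<in> {1..N}. P j = p} \<and> 2 \<le> card I"
  have distinct: "0 < dist (x j t) (x l t)"
    if "t \<in> {0..<T}" "j \<in> {1..N}" "l \<in> {1..N}" "j \<noteq> l" for j l t
    using x that unfolding vortex_solution_def by simp
  have sep: "\<exists>d>0. ((\<lambda>t. dist (x j t) (x l t)) \<longlongrightarrow> d) (at_left T)"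
    if "j \<in> {1..N}" "l \<in> {1..N}" "P j \<noteq> P l" for j l
    using that lim by (intro exI[of _ "dist (P j) (P l)"] conjI tendsto_dist) auto
  have mem: "j \<in> {1..N}" "P j = p" if "j \<in> I" for j
    using that I by auto
  have non_mem: "l \<in> {1..N}" "P j \<noteq> P l" "j \<noteq> l" if "j \<in> I" "l \<in> {1..N} - I" for j l
    using that I by auto
  show "collision_cluster_at N (ereal T) x I T\<^sub>c p"
    unfolding collision_cluster_at_def
  proof (intro conjI ballI impI)
    show "I \<subseteq> {1..N}" "2 \<le> card I" "0 < T\<^sub>c" "ereal T\<^sub>c \<le> ereal T"
      using I \<open>0 < T\<close> by auto
    show "0 < dist (x j t) (x l t)"
      if "t \<in> {0..<T\<^sub>c}" "j \<in> {1..N}" "l \<in> {1..N}" "j \<noteq> l" for t j l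
      using that I distinct by blast
    show "(x j \<longlongrightarrow> p) (at_left T\<^sub>c)" if "j \<in> I" for j
      using lim[OF mem(1)[OF that]] mem(2)[OF that] I by simp
    show "0 < dist (x j t) (x l t)" if "l \<in> {1..N} - I" "j \<in> I" "t \<in> {0..<T\<^sub>c}" for j l t
      using distinct mem(1)[OF that(2)] non_mem[OF that(2,1)] that(3) I by blast
    show "\<exists>d>0. ((\<lambda>t. dist (x j t) (x l t)) \<longlongrightarrow> d) (at_left T\<^sub>c)"
      if "l \<in> {1..N} - I" "j \<in> I" for j l
      using sep mem(1)[OF that(2)] non_mem[OF that(2,1)] I by blast
  qed
qed

section \<open>Fibres of the limit configuration of five vortices\<close>

lemma two_ring_2_center_iff:
  assumes "0 < r" "j \<in> {1..5}"
  shows "two_ring 2 \<theta> 0 r j = 0 \<longleftrightarrow> j \<in> {1, 2, 5}"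
proof -
  have "unit_dir \<phi> \<noteq> 0" for \<phi>
    using norm_unit_dir[of \<phi>] by fastforce
  then show ?thesis
    using assms by (auto simp: two_ring_def)
qed

lemma two_ring_2_outer_distinct:
  assumes "0 < r"
  shows "two_ring 2 \<theta> 0 r 3 \<noteq> two_ring 2 \<theta> 0 r 4"
proof
  assume "two_ring 2 \<theta> 0 r 3 = two_ring 2 \<theta> 0 r 4"
  then have "unit_dir (outer_angle 2 \<theta> 1) = unit_dir (outer_angle 2 \<theta> 2)"
    using assms by (simp add: two_ring_def)
  then show False
    using inj_onD[OF inj_on_unit_dir_angle(2)[of 2 \<theta>], of 1 2] by simp
qed

text \<open>The outer vortices 3 and 4 end at two different nonzero points, so the fibre over the
  origin is the only one with at least two elements. This gives the word "only" in the case
  \<open>n = 2\<close>.\<close>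

lemma two_ring_2_fibre:
  assumes "0 < r"
  shows "I = {j \<in> {1..5}. two_ring 2 \<theta> 0 r j = p} \<and> 2 \<le> card I \<longleftrightarrow> p = 0 \<and> I = {1, 2, 5}"
proof -
  let ?P = "two_ring 2 \<theta> 0 r"
  have fibre_0: "{j \<in> {1..5}. ?P j = 0} = {1, 2, 5}"
    using two_ring_2_center_iff[OF assms] by auto
  have "card {j \<in> {1..5}. ?P j = p} \<le> 1" if "p \<noteq> 0"
  proof -
    have sub: "{j \<in> {1..5}. ?P j = p} \<subseteq> {3, 4}"
    proof
      fix j assume j: "j \<in> {j \<in> {1..5}. ?P j = p}"
      then have "j \<notin> {1, 2, 5}"
        using two_ring_2_center_iff[OF assms, of j] that by auto
      with j show "j \<in> {3, 4}" by auto
    qed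
    have "\<not> {3, 4} \<subseteq> {j \<in> {1..5}. ?P j = p}"
      using two_ring_2_outer_distinct[OF assms, of \<theta>] by auto
    with sub have "{j \<in> {1..5}. ?P j = p} \<subset> {3, 4}"
      by blast
    from psubset_card_mono[OF _ this] show ?thesis
      by simp
  qed
  then have "\<not> 2 \<le> card {j \<in> {1..5}. ?P j = p}" if "p \<noteq> 0"
    using that by fastforce
  moreover have "2 \<le> card {1, 2, 5 :: nat}"
    by simp
  ultimately show ?thesis
    using fibre_0 by metis
qed

text \<open>The growth constants are chosen before the initial data, since the limiting fraction
  depends on \<open>n\<close> alone. Approximate equality for large \<open>n\<close> is read as
  convergence of the difference to 0.\<close>

theorem proposition4p7:
  shows "\<exists>\<alpha>\<^sub>6 \<beta>\<^sub>6 :: nat \<Rightarrow> real.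
    (\<forall>n\<ge>4. 0 < \<alpha>\<^sub>6 n \<and> \<alpha>\<^sub>6 n < \<beta>\<^sub>6 n \<and> \<alpha>\<^sub>6 n + \<beta>\<^sub>6 n = 8 * real n - 12 \<and>
       \<beta>\<^sub>6 n - \<alpha>\<^sub>6 n = 4 * real n *
         ((\<beta>\<^sub>6 n powr (real n / 2) - \<alpha>\<^sub>6 n powr (real n / 2)) /
          (\<beta>\<^sub>6 n powr (real n / 2) + \<alpha>\<^sub>6 n powr (real n / 2)))) \<and>
    (\<lambda>n. \<alpha>\<^sub>6 n - (2 * real n - 6)) \<longlonglongrightarrow> 0 \<and>
    (\<lambda>n. \<beta>\<^sub>6 n - (6 * real n - 6)) \<longlonglongrightarrow> 0 \<and>
    (\<forall>(n::nat) (N::nat) (m\<^sub>0::int) (m::nat \<Rightarrow> int) (\<theta>\<^sub>0::real) (a\<^sub>1::real) (a\<^sub>2::real)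
        (y::nat \<Rightarrow> real ^ 2).
      n \<ge> 2 \<and> N = 2 * n + 1 \<and>
      (m\<^sub>0 = 1 \<or> m\<^sub>0 = -1) \<and> m N = - m\<^sub>0 \<and> (\<forall>j\<in>{1..2 * n}. m j = m\<^sub>0) \<and>
      0 \<le> \<theta>\<^sub>0 \<and> \<theta>\<^sub>0 < 2 * pi \<and> 0 < a\<^sub>1 \<and> a\<^sub>1 < a\<^sub>2 \<and>
      y N = 0 \<and>
      (\<forall>j\<in>{1..n}. y j = a\<^sub>1 *\<^sub>R unit_dir (inner_angle n \<theta>\<^sub>0 j) \<and>
                   y (n + j) = a\<^sub>2 *\<^sub>R unit_dir (outer_angle n \<theta>\<^sub>0 j))
      \<longrightarrow>
      (\<exists>(T::ereal) (x::nat \<Rightarrow> real \<Rightarrow> real ^ 2) (\<rho>\<^sub>1::real \<Rightarrow> real) (\<rho>\<^sub>2::real \<Rightarrow> real).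
        the_vortex_solution N m y T x \<and>
        (\<forall>t. 0 \<le> t \<and> ereal t < T \<longrightarrow>
          0 < \<rho>\<^sub>1 t \<and> 0 < \<rho>\<^sub>2 t \<and>
          x N t = 0 \<and>
          (\<forall>j\<in>{1..n}. x j t = sqrt (\<rho>\<^sub>1 t) *\<^sub>R unit_dir (inner_angle n \<theta>\<^sub>0 j) \<and>
                       x (n + j) t = sqrt (\<rho>\<^sub>2 t) *\<^sub>R unit_dir (outer_angle n \<theta>\<^sub>0 j))) \<and>
        (n = 2 \<longrightarrow>
          (\<forall>I. collision_cluster N T x I \<longleftrightarrow> I = {1, 2, 5}) \<and>
          (\<exists>T\<^sub>c. collision_cluster_at N T x {1, 2, 5} T\<^sub>c 0)) \<and>
        (n = 3 \<longrightarrow>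
          T = \<infinity> \<and>
          \<rho>\<^sub>1 \<sim>[at_top] (\<lambda>t. (a\<^sub>1 * a\<^sub>2 / (a\<^sub>2 - a\<^sub>1))\<^sup>2) \<and>
          \<rho>\<^sub>2 \<sim>[at_top] (\<lambda>t. 12 * t)) \<and>
        (n \<ge> 4 \<longrightarrow>
          T = \<infinity> \<and>
          \<rho>\<^sub>1 \<sim>[at_top] (\<lambda>t. \<alpha>\<^sub>6 n * t) \<and>
          \<rho>\<^sub>2 \<sim>[at_top] (\<lambda>t. \<beta>\<^sub>6 n * t))))"
proof -
  have "\<exists>z. \<forall>n\<ge>4. 0 < z n \<and> z n < 2 / 5 \<and> ratio_field n (z n) = 0 \<and> attracting_ratio n (z n)"
    using exists_attracting_ratio by (intro choice) blast
  then obtain z where z: "\<forall>n\<ge>4. 0 < z n \<and> z n < 2 / 5 \<and> ratio_field n (z n) = 0"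
    "\<And>n. n \<ge> 4 \<Longrightarrow> attracting_ratio n (z n)"
    by blast
  define \<alpha> \<beta> where "\<alpha> = (\<lambda>n. (8 * real n - 12) * z n)" and "\<beta> = (\<lambda>n. (8 * real n - 12) * (1 - z n))"
  note constants = growth_constants[OF z(1)]
  show ?thesis
  proof (rule exI[of _ \<alpha>], rule exI[of _ \<beta>], intro conjI allI impI)
    fix n :: nat assume "4 \<le> n"
    from constants(1)[OF this]
    show "0 < \<alpha> n" "\<alpha> n < \<beta> n" "\<alpha> n + \<beta> n = 8 * real n - 12"
      "\<beta> n - \<alpha> n = 4 * real n *
         ((\<beta> n powr (real n / 2) - \<alpha> n powr (real n / 2)) /
          (\<beta> n powr (real n / 2) + \<alpha> n powr (real n / 2)))"
      unfolding \<alpha>_def \<beta>_def by blast+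
  next
    show "(\<lambda>n. \<alpha> n - (2 * real n - 6)) \<longlonglongrightarrow> 0" "(\<lambda>n. \<beta> n - (6 * real n - 6)) \<longlonglongrightarrow> 0"
      unfolding \<alpha>_def \<beta>_def by (rule constants)+
  next
    fix n N :: nat and m\<^sub>0 :: int and m :: "nat \<Rightarrow> int" and \<theta>\<^sub>0 a\<^sub>1 a\<^sub>2 :: real and y :: "nat \<Rightarrow> real ^ 2"
    assume asm: "n \<ge> 2 \<and> N = 2 * n + 1 \<and>
      (m\<^sub>0 = 1 \<or> m\<^sub>0 = -1) \<and> m N = - m\<^sub>0 \<and> (\<forall>j\<in>{1..2 * n}. m j = m\<^sub>0) \<and>
      0 \<le> \<theta>\<^sub>0 \<and> \<theta>\<^sub>0 < 2 * pi \<and> 0 < a\<^sub>1 \<and> a\<^sub>1 < a\<^sub>2 \<and>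
      y N = 0 \<and>
      (\<forall>j\<in>{1..n}. y j = a\<^sub>1 *\<^sub>R unit_dir (inner_angle n \<theta>\<^sub>0 j) \<and>
                   y (n + j) = a\<^sub>2 *\<^sub>R unit_dir (outer_angle n \<theta>\<^sub>0 j))"
    then have n: "n \<ge> 2" and N: "N = 2 * n + 1" and m\<^sub>0: "m\<^sub>0 = 1 \<or> m\<^sub>0 = -1"
      and m: "m (2 * n + 1) = - m\<^sub>0" "\<forall>j\<in>{1..2 * n}. m j = m\<^sub>0" and a: "0 < a\<^sub>1" "a\<^sub>1 < a\<^sub>2"
      by auto
    define x where "x \<rho>\<^sub>1 \<rho>\<^sub>2 j t = two_ring n \<theta>\<^sub>0 (sqrt (\<rho>\<^sub>1 t)) (sqrt (\<rho>\<^sub>2 t)) j"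
      for \<rho>\<^sub>1 \<rho>\<^sub>2 :: "real \<Rightarrow> real" and j t
    have y: "y j = two_ring n \<theta>\<^sub>0 (sqrt (\<rho>\<^sub>1 0)) (sqrt (\<rho>\<^sub>2 0)) j"
      if "\<rho>\<^sub>1 0 = a\<^sub>1\<^sup>2" "\<rho>\<^sub>2 0 = a\<^sub>2\<^sup>2" "j \<in> {1..2 * n + 1}" for \<rho>\<^sub>1 \<rho>\<^sub>2 :: "real \<Rightarrow> real" and j
      using that(3)
      by (cases rule: two_ring_cases) (use asm that(1,2) in auto)
    note sol = two_ring_vortex_solution[OF n m\<^sub>0 m y, folded N x_def]
    have shape: "x \<rho>\<^sub>1 \<rho>\<^sub>2 N t = 0 \<and>
        (\<forall>j\<in>{1..n}. x \<rho>\<^sub>1 \<rho>\<^sub>2 j t = sqrt (\<rho>\<^sub>1 t) *\<^sub>R unit_dir (inner_angle n \<theta>\<^sub>0 j) \<and>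
          x \<rho>\<^sub>1 \<rho>\<^sub>2 (n + j) t = sqrt (\<rho>\<^sub>2 t) *\<^sub>R unit_dir (outer_angle n \<theta>\<^sub>0 j))" for \<rho>\<^sub>1 \<rho>\<^sub>2 t
      by (simp add: x_def N)
    let ?goal = "\<lambda>T x \<rho>\<^sub>1 \<rho>\<^sub>2. the_vortex_solution N m y T x \<and>
        (\<forall>t. 0 \<le> t \<and> ereal t < T \<longrightarrow>
          0 < \<rho>\<^sub>1 t \<and> 0 < \<rho>\<^sub>2 t \<and>
          x N t = 0 \<and>
          (\<forall>j\<in>{1..n}. x j t = sqrt (\<rho>\<^sub>1 t) *\<^sub>R unit_dir (inner_angle n \<theta>\<^sub>0 j) \<and>
                       x (n + j) t = sqrt (\<rho>\<^sub>2 t) *\<^sub>R unit_dir (outer_angle n \<theta>\<^sub>0 j))) \<and>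
        (n = 2 \<longrightarrow>
          (\<forall>I. collision_cluster N T x I \<longleftrightarrow> I = {1, 2, 5}) \<and>
          (\<exists>T\<^sub>c. collision_cluster_at N T x {1, 2, 5} T\<^sub>c 0)) \<and>
        (n = 3 \<longrightarrow>
          T = \<infinity> \<and>
          \<rho>\<^sub>1 \<sim>[at_top] (\<lambda>t. (a\<^sub>1 * a\<^sub>2 / (a\<^sub>2 - a\<^sub>1))\<^sup>2) \<and>
          \<rho>\<^sub>2 \<sim>[at_top] (\<lambda>t. 12 * t)) \<and>
        (n \<ge> 4 \<longrightarrow>
          T = \<infinity> \<and>
          \<rho>\<^sub>1 \<sim>[at_top] (\<lambda>t. \<alpha> n * t) \<and>
          \<rho>\<^sub>2 \<sim>[at_top] (\<lambda>t. \<beta> n * t))"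
    have "\<exists>T \<rho>\<^sub>1 \<rho>\<^sub>2. ?goal T (x \<rho>\<^sub>1 \<rho>\<^sub>2) \<rho>\<^sub>1 \<rho>\<^sub>2"
    proof (cases "n = 2")
      case True
      obtain T \<rho>\<^sub>1 \<rho>\<^sub>2 where "0 < T" and init: "\<rho>\<^sub>1 0 = a\<^sub>1\<^sup>2" "\<rho>\<^sub>2 0 = a\<^sub>2\<^sup>2"
        and cont: "\<And>t. isCont \<rho>\<^sub>1 t" "\<And>t. isCont \<rho>\<^sub>2 t" and "\<rho>\<^sub>1 T = 0" "0 < \<rho>\<^sub>2 T"
        and pos: "\<And>t. 0 \<le> t \<Longrightarrow> t < T \<Longrightarrow> 0 < \<rho>\<^sub>1 t \<and> \<rho>\<^sub>1 t < \<rho>\<^sub>2 t"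
        and ode: "\<And>t. 0 \<le> t \<Longrightarrow> t < T \<Longrightarrow> (\<rho>\<^sub>1 has_real_derivative
            2 * (real n - 3) + 4 * real n * ring_share n (sqrt (\<rho>\<^sub>1 t)) (sqrt (\<rho>\<^sub>2 t))) (at t)"
          "\<And>t. 0 \<le> t \<Longrightarrow> t < T \<Longrightarrow> (\<rho>\<^sub>2 has_real_derivative
            2 * (real n - 3) + 4 * real n * ring_share n (sqrt (\<rho>\<^sub>2 t)) (sqrt (\<rho>\<^sub>1 t))) (at t)"
        unfolding True by (rule two_collision_radii[OF a]) blast
      let ?x = "x \<rho>\<^sub>1 \<rho>\<^sub>2"
      have x: "vortex_solution N m y (ereal T) ?x"
        using \<open>0 < T\<close> pos ode by (intro sol init) auto
      let ?P = "two_ring 2 \<theta>\<^sub>0 0 (sqrt (\<rho>\<^sub>2 T))"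
      \<comment> \<open>The formula for \<open>?x\<close> remains continuous at \<open>T\<close>,
        where the inner radius is 0; the limit configuration is its value there.\<close>
      have lim: "(?x j \<longlongrightarrow> ?P j) (at_left T)" for j
      proof -
        have "isCont (?x j) T"
          unfolding x_def[abs_def] by (intro isCont_two_ring continuous_intros cont)
        from isCont_tendsto_at_left[OF this] show ?thesis
          by (simp add: x_def \<open>\<rho>\<^sub>1 T = 0\<close> True)
      qed
      have "N = 5"
        using N True by simp
      have "?P 1 = 0" "?P 2 = 0"
        by (simp_all add: two_ring_def)
      then have the_x: "the_vortex_solution N m y (ereal T) ?x"
        using lim[of 1] lim[of 2] \<open>N = 5\<close>
        by (intro the_vortex_solution_until_collision[OF x \<open>0 < T\<close>, of 1 2 0]) auto
      have cluster: "collision_cluster_at N (ereal T) ?x I T\<^sub>c p \<longleftrightarrow> T\<^sub>c = T \<and> p = 0 \<and> I = {1, 2, 5}"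
        for I T\<^sub>c p
        using collision_cluster_at_iff[OF x lim, of I T\<^sub>c p]
          two_ring_2_fibre[of "sqrt (\<rho>\<^sub>2 T)" I \<theta>\<^sub>0 p] \<open>0 < \<rho>\<^sub>2 T\<close> \<open>N = 5\<close> by simp
      have "?goal (ereal T) ?x \<rho>\<^sub>1 \<rho>\<^sub>2"
        using True the_x shape[of \<rho>\<^sub>1 \<rho>\<^sub>2] pos
        by (auto simp: collision_cluster_def cluster intro: less_trans)
      then show ?thesis
        by (intro exI)
    next
      case False
      then have "n \<ge> 3"
        using n by simp
      \<comment> \<open>The limiting fraction of the inner ring. For \<open>n = 3\<close> it is 0,
        so linear growth is lost for the inner ring and its limit has to come from the conserved
        quantity.\<close>
      define w where "w = (if n = 3 then 0 else z n)"
      have "attracting_ratio n w"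
        using z(2)[of n] attracting_ratio_3 \<open>n \<ge> 3\<close> by (simp add: w_def)
      then obtain \<rho>\<^sub>1 \<rho>\<^sub>2 :: "real \<Rightarrow> real" where init: "\<rho>\<^sub>1 0 = a\<^sub>1\<^sup>2" "\<rho>\<^sub>2 0 = a\<^sub>2\<^sup>2"
        and pos: "\<And>t. 0 \<le> t \<Longrightarrow> 0 < \<rho>\<^sub>1 t \<and> \<rho>\<^sub>1 t < \<rho>\<^sub>2 t"
        and ode: "\<And>t. 0 \<le> t \<Longrightarrow> (\<rho>\<^sub>1 has_real_derivative
            2 * (real n - 3) + 4 * real n * ring_share n (sqrt (\<rho>\<^sub>1 t)) (sqrt (\<rho>\<^sub>2 t))) (at t)"
          "\<And>t. 0 \<le> t \<Longrightarrow> (\<rho>\<^sub>2 has_real_derivative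
            2 * (real n - 3) + 4 * real n * ring_share n (sqrt (\<rho>\<^sub>2 t)) (sqrt (\<rho>\<^sub>1 t))) (at t)"
        and lim: "((\<lambda>t. \<rho>\<^sub>1 t / t) \<longlongrightarrow> (8 * real n - 12) * w) at_top"
          "((\<lambda>t. \<rho>\<^sub>2 t / t) \<longlongrightarrow> (8 * real n - 12) * (1 - w)) at_top"
        by (rule exists_squared_radii[OF \<open>n \<ge> 3\<close> a]) blast
      have "vortex_solution N m y \<infinity> (x \<rho>\<^sub>1 \<rho>\<^sub>2)"
        using pos ode by (intro sol init) auto
      then have the_x: "the_vortex_solution N m y \<infinity> (x \<rho>\<^sub>1 \<rho>\<^sub>2)"
        by (rule the_vortex_solution_global)
      have three: "\<rho>\<^sub>1 \<sim>[at_top] (\<lambda>t. (a\<^sub>1 * a\<^sub>2 / (a\<^sub>2 - a\<^sub>1))\<^sup>2) \<and> \<rho>\<^sub>2 \<sim>[at_top] (\<lambda>t. 12 * t)"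
        if "n = 3"
      proof
        show equiv: "\<rho>\<^sub>2 \<sim>[at_top] (\<lambda>t. 12 * t)"
          using lim(2) that by (intro asymp_equiv_linear) (simp_all add: w_def)
        have "filterlim (\<lambda>t :: real. 12 * t) at_top at_top"
          by (intro filterlim_tendsto_pos_mult_at_top[OF tendsto_const]) (auto intro: filterlim_ident)
        then have "filterlim \<rho>\<^sub>2 at_top at_top"
          by (rule asymp_equiv_at_top_transfer[OF asymp_equiv_symI[OF equiv]])
        with a init pos show "\<rho>\<^sub>1 \<sim>[at_top] (\<lambda>t. (a\<^sub>1 * a\<^sub>2 / (a\<^sub>2 - a\<^sub>1))\<^sup>2)"
          by (intro three_inner_radius_limit[of a\<^sub>1 a\<^sub>2 \<rho>\<^sub>1 \<rho>\<^sub>2])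
            (use ode[unfolded that] in simp_all)
      qed
      have four: "\<rho>\<^sub>1 \<sim>[at_top] (\<lambda>t. \<alpha> n * t) \<and> \<rho>\<^sub>2 \<sim>[at_top] (\<lambda>t. \<beta> n * t)" if "n \<ge> 4"
        using lim that constants(1)[OF that]
        by (intro conjI asymp_equiv_linear) (auto simp: w_def \<alpha>_def \<beta>_def)
      have "?goal \<infinity> (x \<rho>\<^sub>1 \<rho>\<^sub>2) \<rho>\<^sub>1 \<rho>\<^sub>2"
        using False the_x shape[of \<rho>\<^sub>1 \<rho>\<^sub>2] pos three four by (auto intro: less_trans)
      then show ?thesis
        by (intro exI)
    qed
    then show "\<exists>T x \<rho>\<^sub>1 \<rho>\<^sub>2. ?goal T x \<rho>\<^sub>1 \<rho>\<^sub>2"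
      by (elim exE) (intro exI)
  qed
qed

end
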